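(* Let $\kappa<0$, $\tau\neq0$ and $H>0$ with $4H^2+\kappa>0$. Let $a=\operatorname{arctanh}(\sqrt{-\kappa}/2H)$ and let $y$ be the function $$y(x)=\arctan\left(\frac{\tau}{H}\rho(x)\right)-\frac{H}{\tau}\frac{\sqrt{4\tau^2-\kappa}}{\sqrt{4H^2+\kappa}}\arctan\left(\frac{\sqrt{4\tau^2-\kappa}}{\sqrt{4H^2+\kappa}}\rho(x)\right),\qquad \rho(x)=\frac{\sqrt{1+\frac{4H^2}{\kappa}\tanh^2x}}{\sqrt{1-\frac{4\tau^2}{\kappa}\tanh^2x}}.$$ Let $\Phi:\,]-a,a[\,\times\,]-\pi,\pi[\ \to\mathrm{Sl}(2,\mathbb{R})$ be the immersion given by $$\Phi(x,t)=\begin{cases}\left(\cosh(x+a)e^{iy(x+a)},\ \sinh(x+a)e^{it}\right)&\text{if }x<0,\\ \left(\cosh(a-x)e^{-iy(a-x)},\ \sinh(a-x)e^{it}\right)&\text{if }x\ge0.\end{cases}$$ Then $\Phi$ defines an immersion of a sphere with constant mean curvature $H$. Moreover, $\Phi$ is an embedding if and only if $y(0)>-\pi$.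
   Context: $\mathrm{Sl}(2,\mathbb{R})$ is identified with $\{(z,w)\in\mathbb{C}^2:|z|^2-|w|^2=1\}$. With the global frame $E^1_{(z,w)}=(\bar w,\bar z)$, $E^2_{(z,w)}=(i\bar w,i\bar z)$, $V_{(z,w)}=(iz,iw)$, the metric is $g(E^i,E^j)=\delta_{ij}\frac{4}{-\kappa}$, $g(V,V)=\frac{16\tau^2}{\kappa^2}$, $g(V,E^j)=0$. Mean curvature is half the trace of the second fundamental form.
   Formalization: For τ<0 the stated criterion fails (κ=-1, τ=-1, H=0.51 gives y(0)≈7.3>-π, yet the sphere self-intersects), so it is replaced there by y(0)<π; for τ>0 it is as stated. Immersion and embedding refer to the smooth sphere completing Φ, reparametrized in x. *)

theory Defs
  imports "HOL-Analysis.Analysis"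
begin

section \<open>The homogeneous space $\mathrm{Sl}(2,R)$\<close>

type_synonym c2 = "complex \<times> complex"

definition sl2r :: "c2 set" where
  "sl2r = {(z, w). (cmod z)\<^sup>2 - (cmod w)\<^sup>2 = 1}"

text \<open>The global frame $E^1, E^2, V$, with indices in the three-element type. The fields are
  given on all of $C^2$ by the same (real linear) formulas.\<close>

definition frame :: "3 \<Rightarrow> c2 \<Rightarrow> c2" where
  "frame i q =
     (if i = 1 then (cnj (snd q), cnj (fst q))
      else if i = 2 then (\<i> * cnj (snd q), \<i> * cnj (fst q))
      else (\<i> * fst q, \<i> * snd q))"

definition tangent :: "c2 \<Rightarrow> c2 set" where
  "tangent q = span (range (\<lambda>i. frame i q))"

text \<open>Coordinates of a tangent vector with respect to the frame: if
  $U = \alpha E^1 + \beta E^2 + \gamma V$ at $(z,w)$ with $|z|^2 - |w|^2 = 1$, then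
  $z U_2 - w U_1 = \alpha + i\beta$ and $\bar z U_1 - \bar w U_2 = i\gamma$.\<close>

definition coords :: "c2 \<Rightarrow> c2 \<Rightarrow> real ^ 3" where
  "coords q U =
     vector [Re (fst q * snd U - snd q * fst U),
             Im (fst q * snd U - snd q * fst U),
             Im (cnj (fst q) * fst U - cnj (snd q) * snd U)]"

definition weight :: "real \<Rightarrow> real \<Rightarrow> real ^ 3" where
  "weight \<kappa> \<tau> = vector [4 / (- \<kappa>), 4 / (- \<kappa>), 16 * \<tau>\<^sup>2 / \<kappa>\<^sup>2]"

definition metric :: "real \<Rightarrow> real \<Rightarrow> c2 \<Rightarrow> c2 \<Rightarrow> c2 \<Rightarrow> real" where
  "metric \<kappa> \<tau> q U W = (\<Sum>i\<in>UNIV. weight \<kappa> \<tau> $ i * coords q U $ i * coords q W $ i)"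

lemma coords_frame:
  assumes "q \<in> sl2r"
  shows "coords q (frame i q) = axis i 1"
proof -
  obtain z w where q: "q = (z, w)" by (cases q)
  have *: "(Re z)\<^sup>2 + (Im z)\<^sup>2 - ((Re w)\<^sup>2 + (Im w)\<^sup>2) = 1"
    using assms by (simp add: q sl2r_def cmod_power2)
  consider "i = 1" | "i = 2" | "i = 3" using exhaust_3 by blast
  then show ?thesis
    using * by cases
      (simp_all add: q coords_def frame_def vec_eq_iff forall_3 axis_def
        algebra_simps power2_eq_square)
qed

lemma coords_linear: "linear (coords q)"
  by (rule linearI)
    (simp_all add: coords_def vec_eq_iff forall_3 algebra_simps)

lemma tangent_eq_sum_frame:
  assumes "q \<in> sl2r" "U \<in> tangent q"
  shows "U = (\<Sum>i\<in>UNIV. coords q U $ i *\<^sub>R frame i q)"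
  using assms(2) unfolding tangent_def
proof (induction rule: span_induct_alt)
  case base
  then show ?case using linear_0[OF coords_linear] by simp
next
  case (step c x y)
  then obtain j where x: "x = frame j q" by blast
  have "(\<Sum>i\<in>UNIV. coords q (c *\<^sub>R x + y) $ i *\<^sub>R frame i q)
      = c *\<^sub>R (\<Sum>i\<in>UNIV. coords q x $ i *\<^sub>R frame i q) + (\<Sum>i\<in>UNIV. coords q y $ i *\<^sub>R frame i q)"
    by (simp add: linear_add[OF coords_linear] linear_scale[OF coords_linear]
        scaleR_add_left sum.distrib scaleR_sum_right)
  moreover have "(\<Sum>i\<in>UNIV. coords q x $ i *\<^sub>R frame i q) = x"
    unfolding x coords_frame[OF assms(1)]
    using exhaust_3[of j] by (auto simp: sum_3 axis_def)
  ultimately show ?case using step by simp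
qed

lemma metric_frame:
  assumes "q \<in> sl2r"
  shows "metric \<kappa> \<tau> q (frame i q) (frame j q) = (if i = j then weight \<kappa> \<tau> $ i else 0)"
  using exhaust_3[of i] exhaust_3[of j]
  by (auto simp: metric_def coords_frame[OF assms] sum_3 axis_def)

text \<open>The Levi-Civita connection, by the Koszul formula. On vector fields of $C^2$ that are
  tangent to \<open>sl2r\<close> along \<open>sl2r\<close>, all terms below depend at points of \<open>sl2r\<close> only on the
  restrictions to it.\<close>

definition lie_bracket :: "(c2 \<Rightarrow> c2) \<Rightarrow> (c2 \<Rightarrow> c2) \<Rightarrow> c2 \<Rightarrow> c2" where
  "lie_bracket X Y q =
     frechet_derivative Y (at q) (X q) - frechet_derivative X (at q) (Y q)"

definition koszul :: "real \<Rightarrow> real \<Rightarrow> (c2 \<Rightarrow> c2) \<Rightarrow> (c2 \<Rightarrow> c2) \<Rightarrow> (c2 \<Rightarrow> c2) \<Rightarrow> c2 \<Rightarrow> real" where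
  "koszul \<kappa> \<tau> X Y Z q =
     (frechet_derivative (\<lambda>r. metric \<kappa> \<tau> r (Y r) (Z r)) (at q) (X q)
      + frechet_derivative (\<lambda>r. metric \<kappa> \<tau> r (X r) (Z r)) (at q) (Y q)
      - frechet_derivative (\<lambda>r. metric \<kappa> \<tau> r (X r) (Y r)) (at q) (Z q)
      + metric \<kappa> \<tau> q (lie_bracket X Y q) (Z q)
      - metric \<kappa> \<tau> q (lie_bracket X Z q) (Y q)
      - metric \<kappa> \<tau> q (lie_bracket Y Z q) (X q)) / 2"

definition levi_civita :: "real \<Rightarrow> real \<Rightarrow> (c2 \<Rightarrow> c2) \<Rightarrow> (c2 \<Rightarrow> c2) \<Rightarrow> c2 \<Rightarrow> c2" where
  "levi_civita \<kappa> \<tau> X Y q =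
     (\<Sum>k\<in>UNIV. (koszul \<kappa> \<tau> X Y (frame k) q / metric \<kappa> \<tau> q (frame k q) (frame k q)) *\<^sub>R frame k q)"


section \<open>Immersions of the sphere\<close>

primrec ck_on ::
  "nat \<Rightarrow> ('a::euclidean_space \<Rightarrow> 'b::real_normed_vector) \<Rightarrow> 'a set \<Rightarrow> bool" where
  "ck_on 0 f U \<longleftrightarrow> continuous_on U f"
| "ck_on (Suc k) f U \<longleftrightarrow>
     (\<forall>x\<in>U. f differentiable (at x)) \<and> (\<forall>v. ck_on k (\<lambda>x. frechet_derivative f (at x) v) U)"

definition smooth_on :: "('a::euclidean_space \<Rightarrow> 'b::real_normed_vector) \<Rightarrow> 'a set \<Rightarrow> bool" where
  "smooth_on f U \<longleftrightarrow> (\<forall>k. ck_on k f U)"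

abbreviation S2 :: "(real ^ 3) set" where
  "S2 \<equiv> sphere 0 1"

text \<open>A map on the sphere is smooth iff its extension, constant along rays, is smooth off the
  origin; on vectors orthogonal to the base point, the derivative of that extension is the
  differential of the map.\<close>

definition radial :: "(real ^ 3 \<Rightarrow> 'b) \<Rightarrow> real ^ 3 \<Rightarrow> 'b" where
  "radial f x = f (x /\<^sub>R norm x)"

definition smooth_S2 :: "(real ^ 3 \<Rightarrow> 'b::real_normed_vector) \<Rightarrow> bool" where
  "smooth_S2 f \<longleftrightarrow> smooth_on (radial f) (- {0})"

definition dS2 :: "(real ^ 3 \<Rightarrow> 'b::real_normed_vector) \<Rightarrow> real ^ 3 \<Rightarrow> real ^ 3 \<Rightarrow> 'b" where
  "dS2 f p v = frechet_derivative (radial f) (at p) v"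

definition tangent_S2 :: "real ^ 3 \<Rightarrow> (real ^ 3) set" where
  "tangent_S2 p = {v. v \<bullet> p = 0}"

definition sphere_immersion :: "(real ^ 3 \<Rightarrow> c2) \<Rightarrow> bool" where
  "sphere_immersion F \<longleftrightarrow>
     F ` S2 \<subseteq> sl2r \<and> smooth_S2 F \<and> (\<forall>p\<in>S2. inj_on (dS2 F p) (tangent_S2 p))"

definition sphere_embedding :: "(real ^ 3 \<Rightarrow> c2) \<Rightarrow> bool" where
  "sphere_embedding F \<longleftrightarrow>
     sphere_immersion F \<and> embedding_map (top_of_set S2) (top_of_set sl2r) F"

definition unit_normal :: "real \<Rightarrow> real \<Rightarrow> (real ^ 3 \<Rightarrow> c2) \<Rightarrow> (real ^ 3 \<Rightarrow> c2) \<Rightarrow> bool" where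
  "unit_normal \<kappa> \<tau> F N \<longleftrightarrow> smooth_S2 N \<and>
     (\<forall>p\<in>S2. N p \<in> tangent (F p) \<and> metric \<kappa> \<tau> (F p) (N p) (N p) = 1 \<and>
        (\<forall>v\<in>tangent_S2 p. metric \<kappa> \<tau> (F p) (N p) (dS2 F p v) = 0))"

text \<open>Covariant derivative of a vector field along a map: Leibniz rule in the frame.\<close>

definition cov_deriv ::
  "real \<Rightarrow> real \<Rightarrow> (real ^ 3 \<Rightarrow> c2) \<Rightarrow> (real ^ 3 \<Rightarrow> c2) \<Rightarrow> real ^ 3 \<Rightarrow> real ^ 3 \<Rightarrow> c2" where
  "cov_deriv \<kappa> \<tau> F N p v =
     (\<Sum>i\<in>UNIV. dS2 (\<lambda>x. coords (F x) (N x) $ i) p v *\<^sub>R frame i (F p)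
        + coords (F p) (N p) $ i *\<^sub>R
            (\<Sum>j\<in>UNIV. coords (F p) (dS2 F p v) $ j *\<^sub>R
               levi_civita \<kappa> \<tau> (frame j) (frame i) (F p)))"

definition second_fundamental_form ::
  "real \<Rightarrow> real \<Rightarrow> (real ^ 3 \<Rightarrow> c2) \<Rightarrow> (real ^ 3 \<Rightarrow> c2) \<Rightarrow> real ^ 3 \<Rightarrow> real ^ 3 \<Rightarrow> real ^ 3 \<Rightarrow> real"
where
  "second_fundamental_form \<kappa> \<tau> F N p v u =
     - metric \<kappa> \<tau> (F p) (cov_deriv \<kappa> \<tau> F N p v) (dS2 F p u)"

definition orthonormal_pair ::
  "real \<Rightarrow> real \<Rightarrow> (real ^ 3 \<Rightarrow> c2) \<Rightarrow> real ^ 3 \<Rightarrow> real ^ 3 \<Rightarrow> real ^ 3 \<Rightarrow> bool" where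
  "orthonormal_pair \<kappa> \<tau> F p v u \<longleftrightarrow>
     v \<in> tangent_S2 p \<and> u \<in> tangent_S2 p \<and>
     metric \<kappa> \<tau> (F p) (dS2 F p v) (dS2 F p v) = 1 \<and>
     metric \<kappa> \<tau> (F p) (dS2 F p u) (dS2 F p u) = 1 \<and>
     metric \<kappa> \<tau> (F p) (dS2 F p v) (dS2 F p u) = 0"

text \<open>The trace is taken in bases of the tangent plane that are orthonormal for the induced
  metric; such bases exist when the map is an immersion.\<close>

definition cmc_sphere_immersion :: "real \<Rightarrow> real \<Rightarrow> real \<Rightarrow> (real ^ 3 \<Rightarrow> c2) \<Rightarrow> bool" where
  "cmc_sphere_immersion \<kappa> \<tau> H F \<longleftrightarrow> sphere_immersion F \<and>
     (\<exists>N. unit_normal \<kappa> \<tau> F N \<and>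
       (\<forall>p\<in>S2. \<forall>v u. orthonormal_pair \<kappa> \<tau> F p v u \<longrightarrow>
          (second_fundamental_form \<kappa> \<tau> F N p v v
           + second_fundamental_form \<kappa> \<tau> F N p u u) / 2 = H))"

definition spherical :: "(real \<Rightarrow> real) \<Rightarrow> real \<times> real \<Rightarrow> real ^ 3" where
  "spherical \<sigma> = (\<lambda>(x, t).
     vector [sqrt (1 - (\<sigma> x)\<^sup>2) * cos t, sqrt (1 - (\<sigma> x)\<^sup>2) * sin t, \<sigma> x])"

text \<open>A map on the rectangle $]-a,a[ \times ]-\pi,\pi[$ defines an immersion \<open>F\<close> of the sphere
  if \<open>F\<close> restricts to it in spherical coordinates with height \<open>\<sigma> x\<close> and longitude \<open>t\<close>; the
  image of these coordinates is the sphere without a closed meridian, so \<open>F\<close> is then the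
  continuous extension. The height is allowed to fail to be differentiable at \<open>0\<close>, because the
  profile curve below has an infinite slope there and is only regular after a change of
  parameter.\<close>

definition defines_sphere ::
  "real \<Rightarrow> (real \<times> real \<Rightarrow> c2) \<Rightarrow> (real ^ 3 \<Rightarrow> c2) \<Rightarrow> bool" where
  "defines_sphere a \<Phi> F \<longleftrightarrow> sphere_immersion F \<and>
     (\<exists>\<sigma>. strict_mono_on {-a<..<a} \<sigma> \<and> \<sigma> ` {-a<..<a} = {-1<..<1} \<and>
          (\<forall>x\<in>{-a<..<a} - {0}. \<exists>d>0. (\<sigma> has_real_derivative d) (at x)) \<and>
          (\<forall>q \<in> {-a<..<a} \<times> {-pi<..<pi}. F (spherical \<sigma> q) = \<Phi> q))"


section \<open>The rotationally invariant spheres\<close>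

definition half_length :: "real \<Rightarrow> real \<Rightarrow> real" where
  "half_length \<kappa> H = artanh (sqrt (- \<kappa>) / (2 * H))"

definition prof_rho :: "real \<Rightarrow> real \<Rightarrow> real \<Rightarrow> real \<Rightarrow> real" where
  "prof_rho \<kappa> \<tau> H x =
     sqrt (1 + 4 * H\<^sup>2 / \<kappa> * (tanh x)\<^sup>2) / sqrt (1 - 4 * \<tau>\<^sup>2 / \<kappa> * (tanh x)\<^sup>2)"

definition prof_y :: "real \<Rightarrow> real \<Rightarrow> real \<Rightarrow> real \<Rightarrow> real" where
  "prof_y \<kappa> \<tau> H x =
     arctan (\<tau> / H * prof_rho \<kappa> \<tau> H x)
     - H / \<tau> * (sqrt (4 * \<tau>\<^sup>2 - \<kappa>) / sqrt (4 * H\<^sup>2 + \<kappa>))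
       * arctan (sqrt (4 * \<tau>\<^sup>2 - \<kappa>) / sqrt (4 * H\<^sup>2 + \<kappa>) * prof_rho \<kappa> \<tau> H x)"

definition Phi :: "real \<Rightarrow> real \<Rightarrow> real \<Rightarrow> real \<times> real \<Rightarrow> c2" where
  "Phi \<kappa> \<tau> H = (\<lambda>(x, t). let a = half_length \<kappa> H in
     if x < 0
     then (of_real (cosh (x + a)) * exp (\<i> * of_real (prof_y \<kappa> \<tau> H (x + a))),
           of_real (sinh (x + a)) * exp (\<i> * of_real t))
     else (of_real (cosh (a - x)) * exp (- (\<i> * of_real (prof_y \<kappa> \<tau> H (a - x)))),
           of_real (sinh (a - x)) * exp (\<i> * of_real t)))"

end

theory Submission
  imports Defs
begin

text \<open>Put $h = -\rho$ for $x < 0$ and $h = \rho$ for $x \ge 0$, and use $h$ as the height of a point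
  $p$ of the unit sphere over its equator, so that
  $\tanh^2 s = -\kappa (1 - h^2) / (4 (H^2 + \tau^2 h^2))$ for $s = a - |x|$. In terms of $h$ the
  profile curve has no square roots that vanish: with $D = 4H^2 + \kappa + (4\tau^2 - \kappa) h^2$,
  \[ z = 2 (H - i \tau h) e^{i \omega(h)} / \sqrt{D}, \qquad
     w = \sqrt{-\kappa}\, (p_1 + i p_2) / \sqrt{D}, \]
  where $y = \arctan(\tau \rho / H) - \omega(\rho)$. Hence the surface is the restriction of a
  smooth map of $R^3$ to the sphere, poles and equator included. In the global frame its
  unit normal at $p$ is $-\frac{1}{2} \sqrt{-\kappa}\, e^{i \omega(h)} (p_1 + i p_2)$ in the plane of
  $E^1, E^2$ and $\frac{\kappa}{4\tau} p_3$ along $V$, which is again smooth. The mean curvature is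
  the trace of the second fundamental form in an explicit orthonormal basis of the tangent plane.

  Since $|z| = \cosh s$ determines $|x|$, two points of the sphere have the same image only
  if they are interchanged by $x \mapsto -x$ and $e^{2iy(s)} = 1$. As $|y|$ decreases to $0$ on
  $[0, a]$ and vanishes only at $a$, this happens exactly if $|y(0)| \ge \pi$.\<close>

section \<open>Smooth maps on the sphere\<close>

text \<open>\<open>Phi\<close> is no smooth chart across x = 0: the numerator under the root in
  \<rho> vanishes at s = a, so \<rho> and y have infinite slope there. All data depend on s through
  \<rho>, which makes h the regular parameter. The factor D is 4(H^2 + \<tau>^2 h^2)(1 - tanh^2 s),
  the common denominator of cosh^2 s and sinh^2 s. The summand arctan(\<tau> \<rho> / H) of y is the
  argument of H + i \<tau> \<rho>, hence it is absorbed into an algebraic factor; what remains is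
  \<omega>, whose derivative is a constant multiple of 1/D. The tangent plane at p gets coordinates
  (x, y) in which the induced metric is Euclidean. The change of coordinates has determinant -D^2 /
  (16 (H^2 + \<tau>^2)), so it stays regular at the poles, where the longitude is arbitrary. With C
  = 4\<tau>^2 - \<kappa> and r^2 = 1 - h^2, the diagonal entries of the second fundamental form are
  H + H C r^2 / (4S) and H D / (4S), S = H^2 + \<tau>^2, and D + C r^2 = 4S gives the trace 2H. The
  embedding criterion concerns every F that \<open>Phi\<close> defines, with an unknown height
  function; its values on the missing meridian and at the poles come from continuity.\<close>

lemma ck_on_cong:
  assumes "open U" "\<And>x. x \<in> U \<Longrightarrow> f x = g x"
  shows "ck_on k f U \<longleftrightarrow> ck_on k g U"
  using assms(2)
proof (induction k arbitrary: f g)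
  case 0
  then show ?case by (simp cong: continuous_on_cong)
next
  case (Suc k)
  have hd: "(f has_derivative f') (at x) \<longleftrightarrow> (g has_derivative f') (at x)" if "x \<in> U" for x f'
    using has_derivative_transform_within_open[OF _ assms(1) that, of f f' UNIV g]
      has_derivative_transform_within_open[OF _ assms(1) that, of g f' UNIV f] Suc.prems by auto
  have d: "f differentiable (at x) \<longleftrightarrow> g differentiable (at x)" if "x \<in> U" for x
    using hd[OF that] by (simp add: differentiable_def)
  have "frechet_derivative f (at x) = frechet_derivative g (at x)" if "x \<in> U" for x
    using hd[OF that] by (simp add: frechet_derivative_def)
  then have "ck_on k (\<lambda>x. frechet_derivative f (at x) v) U
      \<longleftrightarrow> ck_on k (\<lambda>x. frechet_derivative g (at x) v) U" for v
    by (intro Suc.IH) simp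
  then show ?case using d by simp
qed

text \<open>Allows an explicit derivative in place of the \<open>frechet_derivative\<close> that the
  recursion of \<open>ck_on\<close> mentions; openness of U makes the two interchangeable at every
  further order.\<close>

lemma ck_on_SucI:
  assumes "open U" "\<And>x. x \<in> U \<Longrightarrow> (f has_derivative f' x) (at x)"
    and "\<And>v. ck_on k (\<lambda>x. f' x v) U"
  shows "ck_on (Suc k) f U"
proof -
  have "ck_on k (\<lambda>x. frechet_derivative f (at x) v) U \<longleftrightarrow> ck_on k (\<lambda>x. f' x v) U" for v
    using frechet_derivative_at[OF assms(2)] by (intro ck_on_cong assms(1)) metis
  then show ?thesis using assms by (auto simp: differentiable_def)
qed

lemma ck_on_SucD: "ck_on (Suc k) f U \<Longrightarrow> ck_on k f U"
proof (induction k arbitrary: f)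
  case 0
  then show ?case
    by (auto intro!: continuous_at_imp_continuous_on differentiable_imp_continuous_within)
next
  case (Suc k)
  then show ?case unfolding ck_on.simps(2)[of "Suc k"] ck_on.simps(2)[of k] by blast
qed

lemma ck_on_derivative:
  assumes "ck_on (Suc k) f U" "x \<in> U"
  shows "(f has_derivative frechet_derivative f (at x)) (at x)"
  using assms by (simp add: frechet_derivative_works[symmetric])

lemma ck_on_const: "ck_on k (\<lambda>x. c) U"
  by (induction k arbitrary: c) (simp_all add: frechet_derivative_const)

lemma ck_on_linear:
  assumes "open U" "bounded_linear L" "ck_on k f U"
  shows "ck_on k (\<lambda>x. L (f x)) U"
  using assms(3)
proof (induction k arbitrary: f)
  case 0
  then show ?case by (simp add: bounded_linear.continuous_on[OF assms(2)])
next
  case (Suc k)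
  show ?case
    by (rule ck_on_SucI[OF assms(1) bounded_linear.has_derivative[OF assms(2) ck_on_derivative[OF Suc.prems]]])
      (use Suc in simp_all)
qed

lemma ck_on_add:
  assumes "open U" "ck_on k f U" "ck_on k g U"
  shows "ck_on k (\<lambda>x. f x + g x) U"
  using assms(2,3)
proof (induction k arbitrary: f g)
  case 0
  then show ?case by (simp add: continuous_on_add)
next
  case (Suc k)
  show ?case
    by (rule ck_on_SucI[OF assms(1) has_derivative_add[OF ck_on_derivative[OF Suc.prems(1)] ck_on_derivative[OF Suc.prems(2)]]])
      (use Suc in simp_all)
qed

lemma ck_on_bilinear:
  assumes "open U" "bounded_bilinear B" "ck_on k f U" "ck_on k g U"
  shows "ck_on k (\<lambda>x. B (f x) (g x)) U"
  using assms(3,4)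
proof (induction k arbitrary: f g)
  case 0
  then show ?case by (simp add: bounded_bilinear.continuous_on[OF assms(2)])
next
  case (Suc k)
  have "ck_on k (\<lambda>x. B (f x) (frechet_derivative g (at x) v) + B (frechet_derivative f (at x) v) (g x)) U" for v
    using Suc ck_on_SucD[OF Suc.prems(1)] ck_on_SucD[OF Suc.prems(2)]
    by (intro ck_on_add[OF assms(1)]) simp_all
  show ?case
    by (rule ck_on_SucI[OF assms(1) bounded_bilinear.FDERIV[OF assms(2) ck_on_derivative[OF Suc.prems(1)] ck_on_derivative[OF Suc.prems(2)]]])
      (assumption, assumption, fact)
qed

text \<open>Raises the order by one when the outer derivative, composed with f, is already of class
  k. The derivatives of \<open>inverse\<close>, \<open>sqrt\<close> and \<open>cis\<close> are
  expressed through these functions themselves, so an induction on k feeds this lemma its own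
  conclusion; the derivative of \<open>arctan\<close> is rational and needs no induction.\<close>

lemma ck_on_compose_deriv:
  fixes \<phi> :: "real \<Rightarrow> 'b::real_normed_vector"
  assumes "open U" "ck_on (Suc k) f U"
    and "\<And>x. x \<in> U \<Longrightarrow> (\<phi> has_vector_derivative \<phi>' (f x)) (at (f x))"
    and "ck_on k (\<lambda>x. \<phi>' (f x)) U"
  shows "ck_on (Suc k) (\<lambda>x. \<phi> (f x)) U"
proof (rule ck_on_SucI[OF assms(1)])
  show "((\<lambda>x. \<phi> (f x)) has_derivative (\<lambda>v. frechet_derivative f (at x) v *\<^sub>R \<phi>' (f x))) (at x)" if "x \<in> U" for x
    using has_derivative_compose[OF ck_on_derivative[OF assms(2) that] assms(3)[OF that, unfolded has_vector_derivative_def]] .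
  show "ck_on k (\<lambda>x. frechet_derivative f (at x) v *\<^sub>R \<phi>' (f x)) U" for v
    using assms(2,4) by (intro ck_on_bilinear[OF assms(1) bounded_bilinear_scaleR]) simp_all
qed

lemma ck_on_inverse:
  fixes f :: "'a::euclidean_space \<Rightarrow> real"
  assumes "open U" "ck_on k f U" "\<And>x. x \<in> U \<Longrightarrow> f x \<noteq> 0"
  shows "ck_on k (\<lambda>x. inverse (f x)) U"
  using assms(2)
proof (induction k)
  case 0
  then show ?case using assms(3) by (simp add: continuous_on_inverse)
next
  case (Suc k)
  have i: "ck_on k (\<lambda>x. inverse (f x)) U" using Suc ck_on_SucD by blast
  have "ck_on k (\<lambda>x. - (inverse (f x) * inverse (f x))) U"
    by (intro ck_on_linear[OF assms(1) bounded_linear_minus[OF bounded_linear_ident]]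
        ck_on_bilinear[OF assms(1) bounded_bilinear_mult] i)
  moreover have "(inverse has_vector_derivative - (inverse (f x) * inverse (f x))) (at (f x))" if "x \<in> U" for x
    using DERIV_inverse[of "f x" UNIV] assms(3)[OF that]
    by (simp add: has_real_derivative_iff_has_vector_derivative power2_eq_square)
  ultimately show ?case
    by (intro ck_on_compose_deriv[OF assms(1) Suc.prems]) auto
qed

lemma ck_on_sqrt:
  fixes f :: "'a::euclidean_space \<Rightarrow> real"
  assumes "open U" "ck_on k f U" "\<And>x. x \<in> U \<Longrightarrow> f x > 0"
  shows "ck_on k (\<lambda>x. sqrt (f x)) U"
  using assms(2)
proof (induction k)
  case 0
  then show ?case by (simp add: continuous_on_real_sqrt)
next
  case (Suc k)
  have "ck_on k (\<lambda>x. inverse (sqrt (f x)) / 2) U"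
    using Suc ck_on_SucD assms(3)
    by (intro ck_on_linear[OF assms(1) bounded_linear_divide] ck_on_inverse[OF assms(1)]) force+
  moreover have "(sqrt has_vector_derivative inverse (sqrt (f x)) / 2) (at (f x))" if "x \<in> U" for x
    using DERIV_real_sqrt[OF assms(3)[OF that]]
    by (simp add: has_real_derivative_iff_has_vector_derivative)
  ultimately show ?case
    by (intro ck_on_compose_deriv[OF assms(1) Suc.prems]) auto
qed

lemma ck_on_arctan:
  fixes f :: "'a::euclidean_space \<Rightarrow> real"
  assumes "open U" "ck_on k f U"
  shows "ck_on k (\<lambda>x. arctan (f x)) U"
proof (cases k)
  case 0
  then show ?thesis using assms by (simp add: continuous_on_arctan)
next
  case (Suc j)
  have f: "ck_on j f U" using assms(2) Suc ck_on_SucD by blast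
  have nz: "1 + x * x \<noteq> 0" for x :: real
    by (metis add_eq_0_iff not_one_le_zero zero_le_square neg_le_0_iff_le zero_le_one add_increasing2 order_refl)
  have "ck_on j (\<lambda>x. inverse (1 + f x * f x)) U"
    by (intro ck_on_inverse[OF assms(1)] ck_on_add[OF assms(1)] ck_on_const
        ck_on_bilinear[OF assms(1) bounded_bilinear_mult] f nz)
  moreover have "(arctan has_vector_derivative inverse (1 + y * y)) (at y)" for y
    using DERIV_arctan[of y]
    by (simp add: has_real_derivative_iff_has_vector_derivative power2_eq_square)
  ultimately show ?thesis
    unfolding Suc by (intro ck_on_compose_deriv[OF assms(1) assms(2)[unfolded Suc]]) auto
qed

lemma ck_on_cis:
  fixes f :: "'a::euclidean_space \<Rightarrow> real"
  assumes "open U" "ck_on k f U"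
  shows "ck_on k (\<lambda>x. cis (f x)) U"
  using assms(2)
proof (induction k)
  case 0
  then show ?case by (simp add: continuous_on_cis)
next
  case (Suc k)
  have "ck_on k (\<lambda>x. \<i> * cis (f x)) U"
    using Suc ck_on_SucD by (intro ck_on_linear[OF assms(1) bounded_linear_mult_right]) blast
  moreover have "(cis has_vector_derivative \<i> * cis y) (at y)" for y
    by (auto simp: has_vector_derivative_complex_iff intro!: derivative_eq_intros)
  ultimately show ?case
    by (intro ck_on_compose_deriv[OF assms(1) Suc.prems]) auto
qed

section \<open>Smooth maps on the sphere through their radial extensions\<close>

lemma smooth_S2_iff: "smooth_S2 f \<longleftrightarrow> (\<forall>k. ck_on k (\<lambda>x. f (x /\<^sub>R norm x)) (- {0}))"
  unfolding smooth_S2_def smooth_on_def radial_def[abs_def] ..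

lemma smooth_S2_const: "smooth_S2 (\<lambda>p. c)"
  by (auto simp: smooth_S2_iff intro!: ck_on_const)

lemma smooth_S2_linear:
  assumes "bounded_linear L" "smooth_S2 f"
  shows "smooth_S2 (\<lambda>p. L (f p))"
  using assms(2) ck_on_linear[OF open_Compl[OF closed_singleton] assms(1)]
  unfolding smooth_S2_iff by blast

lemma smooth_S2_add:
  assumes "smooth_S2 f" "smooth_S2 g"
  shows "smooth_S2 (\<lambda>p. f p + g p)"
  using assms ck_on_add[OF open_Compl[OF closed_singleton]]
  unfolding smooth_S2_iff by blast

lemma smooth_S2_bilinear:
  assumes "bounded_bilinear B" "smooth_S2 f" "smooth_S2 g"
  shows "smooth_S2 (\<lambda>p. B (f p) (g p))"
  using assms(2,3) ck_on_bilinear[OF open_Compl[OF closed_singleton] assms(1)]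
  unfolding smooth_S2_iff by blast

lemmas smooth_S2_mult = smooth_S2_bilinear[OF bounded_bilinear_mult]
lemmas smooth_S2_of_real = smooth_S2_linear[OF bounded_linear_of_real]
lemmas smooth_S2_cnj = smooth_S2_linear[OF bounded_linear_cnj]

lemma smooth_S2_Pair:
  assumes "smooth_S2 f" "smooth_S2 g"
  shows "smooth_S2 (\<lambda>p. (f p, g p))"
proof -
  have "smooth_S2 (\<lambda>p. (f p, 0) + (0, g p))"
    using assms by (intro smooth_S2_add smooth_S2_linear[of "\<lambda>a. (a, 0)"] smooth_S2_linear[of "Pair 0"]
        bounded_linear_Pair bounded_linear_ident bounded_linear_zero)
  then show ?thesis by simp
qed

lemma smooth_S2_inverse:
  fixes f :: "real ^ 3 \<Rightarrow> real"
  shows "smooth_S2 f \<Longrightarrow> (\<And>p. f p \<noteq> 0) \<Longrightarrow> smooth_S2 (\<lambda>p. inverse (f p))"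
  by (auto simp: smooth_S2_iff intro!: ck_on_inverse)

lemma smooth_S2_sqrt:
  fixes f :: "real ^ 3 \<Rightarrow> real"
  shows "smooth_S2 f \<Longrightarrow> (\<And>p. f p > 0) \<Longrightarrow> smooth_S2 (\<lambda>p. sqrt (f p))"
  by (auto simp: smooth_S2_iff intro!: ck_on_sqrt)

lemma smooth_S2_arctan: "smooth_S2 f \<Longrightarrow> smooth_S2 (\<lambda>p. arctan (f p))"
  by (auto simp: smooth_S2_iff intro!: ck_on_arctan)

lemma smooth_S2_cis: "smooth_S2 f \<Longrightarrow> smooth_S2 (\<lambda>p. cis (f p))"
  by (auto simp: smooth_S2_iff intro!: ck_on_cis)

lemma ck_on_ident: "open U \<Longrightarrow> ck_on k (\<lambda>x. x) U"
  by (cases k) (auto intro!: ck_on_SucI derivative_intros ck_on_const continuous_intros)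

text \<open>The radial extension of a coordinate is x_i / |x|. Writing |x| as the root of x
  \<bullet> x brings it under the rules for \<open>sqrt\<close> and \<open>inverse\<close>, since x
  \<bullet> x is positive off the origin.\<close>

lemma smooth_S2_component: "smooth_S2 (\<lambda>p. p $ i)"
proof -
  have "ck_on k (\<lambda>x::real^3. inverse (sqrt (x \<bullet> x)) * x $ i) (- {0})" for k
  proof -
    have o: "open (- {0 :: real^3})" by (rule open_Compl[OF closed_singleton])
    show ?thesis
      by (intro ck_on_bilinear[OF o bounded_bilinear_mult] ck_on_inverse[OF o] ck_on_sqrt[OF o]
          ck_on_bilinear[OF o bounded_bilinear_inner] ck_on_linear[OF o bounded_linear_vec_nth]
          ck_on_ident[OF o]) auto
  qed
  then show ?thesis
    by (simp add: smooth_S2_iff norm_eq_sqrt_inner)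
qed

lemma smooth_S2_continuous_on:
  assumes "smooth_S2 f"
  shows "continuous_on S2 f"
proof -
  have "continuous_on (- {0}) (radial f)"
    using assms by (auto simp: smooth_S2_def smooth_on_def dest: spec[of _ 0])
  then have "continuous_on S2 (radial f)"
    by (rule continuous_on_subset) auto
  moreover have "radial f p = f p" if "p \<in> S2" for p
    using that by (simp add: radial_def)
  ultimately show ?thesis using continuous_on_cong by metis
qed

section \<open>The differential on the sphere\<close>

text \<open>At a unit vector p the derivative of x / |x| is the orthogonal projection onto the
  complement of p. On tangent vectors it is the identity, so the differential of a map given on all
  of R^3 is its ordinary derivative.\<close>

lemma has_derivative_radial:
  assumes "(f has_derivative f') (at p)" "p \<in> S2"
  shows "(radial f has_derivative (\<lambda>v. f' (v - (v \<bullet> p) *\<^sub>R p))) (at p)"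
proof -
  have n: "norm p = 1" and p0: "p \<noteq> 0" using assms(2) by auto
  have "((\<lambda>x. x /\<^sub>R norm x) has_derivative (\<lambda>v. v - (v \<bullet> p) *\<^sub>R p)) (at p)"
    using p0 n has_derivative_norm[OF p0]
    by (auto intro!: derivative_eq_intros simp: sgn_div_norm inner_commute)
  moreover have "(f has_derivative f') (at (p /\<^sub>R norm p))" using assms(1) n by simp
  ultimately show ?thesis
    unfolding radial_def by (rule has_derivative_compose)
qed

lemma dS2_eq:
  assumes "(f has_derivative f') (at p)" "p \<in> S2" "v \<in> tangent_S2 p"
  shows "dS2 f p v = f' v"
  using frechet_derivative_at[OF has_derivative_radial[OF assms(1,2)], symmetric] assms(3)
  by (simp add: dS2_def tangent_S2_def)

text \<open>Radial extensions see only the values on the sphere. This matters for the frame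
  coordinates of a field along the surface, which have their simple form only where the base point
  lies in \<open>sl2r\<close>.\<close>

lemma dS2_cong:
  assumes "\<And>p. p \<in> S2 \<Longrightarrow> f p = g p"
  shows "p \<in> S2 \<Longrightarrow> dS2 f p v = dS2 g p v"
proof -
  assume p: "p \<in> S2"
  have eq: "radial f x = radial g x" if "x \<in> - {0}" for x
    using that by (simp add: radial_def assms)
  have "p \<in> - {0}" using p by auto
  then have "(radial f has_derivative D) (at p) \<longleftrightarrow> (radial g has_derivative D) (at p)" for D
    using has_derivative_transform_within_open[of _ D p UNIV "- {0}"] eq by (metis open_delete open_UNIV Compl_eq_Diff_UNIV)
  then show ?thesis by (simp add: dS2_def frechet_derivative_def)
qed

section \<open>The connection in the global frame\<close>

text \<open>Joins the coefficients of E^1 and E^2 into one complex number, so that rotations of the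
  horizontal plane become multiplications by unit complex numbers. \<open>ver\<close> is the
  coefficient of V, and \<open>in_frame\<close> builds the vector back from both.\<close>

definition hor :: "c2 \<Rightarrow> c2 \<Rightarrow> complex" where
  "hor q U = fst q * snd U - snd q * fst U"

definition ver :: "c2 \<Rightarrow> c2 \<Rightarrow> real" where
  "ver q U = Im (cnj (fst q) * fst U - cnj (snd q) * snd U)"

definition in_frame :: "c2 \<Rightarrow> complex \<Rightarrow> real \<Rightarrow> c2" where
  "in_frame q \<alpha> c = (\<alpha> * cnj (snd q) + \<i> * of_real c * fst q, \<alpha> * cnj (fst q) + \<i> * of_real c * snd q)"

lemma coords_nth:
  "coords q U $ 1 = Re (hor q U)" "coords q U $ 2 = Im (hor q U)" "coords q U $ 3 = ver q U"
  by (simp_all add: coords_def hor_def ver_def)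

lemma frame_simps:
  "frame 1 q = in_frame q 1 0" "frame 2 q = in_frame q \<i> 0" "frame 3 q = in_frame q 0 1"
  by (simp_all add: frame_def in_frame_def)

lemma in_frame_add: "in_frame q \<alpha> c + in_frame q \<beta> d = in_frame q (\<alpha> + \<beta>) (c + d)"
  by (simp add: in_frame_def algebra_simps)

lemma in_frame_scaleR: "r *\<^sub>R in_frame q \<alpha> c = in_frame q (of_real r * \<alpha>) (r * c)"
  by (simp add: in_frame_def scaleR_conv_of_real algebra_simps)

lemma frame_sum:
  "(\<Sum>i\<in>UNIV. c i *\<^sub>R frame i q) = in_frame q (Complex (c 1) (c 2)) (c 3)"
  by (simp add: sum_3 frame_simps in_frame_scaleR in_frame_add Complex_eq mult.commute)

lemma sl2r_cnj:
  assumes "q \<in> sl2r"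
  shows "fst q * cnj (fst q) - snd q * cnj (snd q) = 1"
proof -
  have "fst q * cnj (fst q) - snd q * cnj (snd q) = of_real ((cmod (fst q))\<^sup>2 - (cmod (snd q))\<^sup>2)"
    unfolding of_real_diff complex_norm_square ..
  also have "(cmod (fst q))\<^sup>2 - (cmod (snd q))\<^sup>2 = 1"
    using assms by (auto simp: sl2r_def)
  finally show ?thesis by simp
qed

lemma hor_in_frame:
  assumes "q \<in> sl2r"
  shows "hor q (in_frame q \<alpha> c) = \<alpha>"
proof -
  have "hor q (in_frame q \<alpha> c) = \<alpha> * (fst q * cnj (fst q) - snd q * cnj (snd q))"
    by (simp add: hor_def in_frame_def algebra_simps)
  then show ?thesis by (simp add: sl2r_cnj[OF assms])
qed

lemma ver_in_frame:
  assumes "q \<in> sl2r"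
  shows "ver q (in_frame q \<alpha> c) = c"
proof -
  \<comment> \<open>The horizontal part contributes a difference of two equal terms; it is kept
    under an \<open>Im\<close> of its own, where it vanishes.\<close>
  have "ver q (in_frame q \<alpha> c) = Im (\<i> * of_real c * (fst q * cnj (fst q) - snd q * cnj (snd q)))
      + Im (\<alpha> * (cnj (fst q) * cnj (snd q)) - \<alpha> * (cnj (fst q) * cnj (snd q)))"
    unfolding ver_def in_frame_def fst_conv snd_conv
    by (subst plus_complex.simps[symmetric]) (simp only: algebra_simps)
  then show ?thesis by (simp add: sl2r_cnj[OF assms])
qed

lemma in_frame_tangent: "in_frame q \<alpha> c \<in> tangent q"
proof -
  have "in_frame q \<alpha> c = Re \<alpha> *\<^sub>R frame 1 q + Im \<alpha> *\<^sub>R frame 2 q + c *\<^sub>R frame 3 q"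
    unfolding frame_simps in_frame_scaleR in_frame_add
    by (rule arg_cong2[where f = "in_frame q"]) (simp_all add: complex_eq_iff)
  then show ?thesis
    unfolding tangent_def by (simp only:) (intro span_add span_scale span_base rangeI)
qed

lemma metric_eq:
  "metric \<kappa> \<tau> q U W = 4 / (- \<kappa>) * Re (cnj (hor q U) * hor q W) + 16 * \<tau>\<^sup>2 / \<kappa>\<^sup>2 * (ver q U * ver q W)"
  by (simp add: metric_def sum_3 weight_def coords_nth algebra_simps)

section \<open>Brackets and covariant derivatives of the frame\<close>

lemma frame_has_derivative: "(frame i has_derivative frame i) (at q)"
proof -
  have "linear (frame i)"
    by (rule linearI) (auto simp: frame_def scaleR_conv_of_real algebra_simps split: if_splits)
  then show ?thesis
    by (intro bounded_linear_imp_has_derivative linear_conv_bounded_linear[THEN iffD1])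
qed

text \<open>The frame fields are real linear maps of C^2, each its own derivative, so their brackets
  are commutators.\<close>

lemma lie_bracket_frame:
  "lie_bracket (frame i) (frame j) q = frame j (frame i q) - frame i (frame j q)"
  by (simp add: lie_bracket_def frechet_derivative_at[OF frame_has_derivative, symmetric])

text \<open>Off \<open>sl2r\<close> the frame is orthogonal of squared length proportional to
  $(|z|^2 - |w|^2)^2$, whose derivatives along the frame vanish.\<close>

lemma metric_frame_derivative:
  "frechet_derivative (\<lambda>r. metric \<kappa> \<tau> r (frame i r) (frame j r)) (at q) (frame k q) = 0"
proof -
  define f :: "c2 \<Rightarrow> real" where "f r = fst r \<bullet> fst r - snd r \<bullet> snd r" for r
  have "coords r (frame i r) $ l = (if i = l then f r else 0)" for r i l
    using exhaust_3[of i] exhaust_3[of l]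
    by (auto simp: coords_nth hor_def ver_def frame_def f_def inner_complex_def algebra_simps)
  then have "metric \<kappa> \<tau> r (frame i r) (frame j r) = (if i = j then weight \<kappa> \<tau> $ i else 0) * (f r * f r)" for r
    using exhaust_3[of i] exhaust_3[of j] by (auto simp: metric_def sum_3)
  then have m: "(\<lambda>r. metric \<kappa> \<tau> r (frame i r) (frame j r)) = (\<lambda>r. (if i = j then weight \<kappa> \<tau> $ i else 0) * (f r * f r))"
    by simp
  have "(f has_derivative (\<lambda>U. 2 * (fst q \<bullet> fst U) - 2 * (snd q \<bullet> snd U))) (at q)"
    unfolding f_def by (auto intro!: derivative_eq_intros simp: inner_commute)
  then have "((\<lambda>r. (if i = j then weight \<kappa> \<tau> $ i else 0) * (f r * f r)) has_derivative
     (\<lambda>U. (if i = j then weight \<kappa> \<tau> $ i else 0) * (2 * f q * (2 * (fst q \<bullet> fst U) - 2 * (snd q \<bullet> snd U))))) (at q)"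
    by (auto intro!: derivative_eq_intros simp: algebra_simps)
  note d = frechet_derivative_at[OF this, symmetric]
  have "2 * (fst q \<bullet> fst (frame k q)) - 2 * (snd q \<bullet> snd (frame k q)) = 0"
    using exhaust_3[of k] by (auto simp: frame_def inner_complex_def)
  then show ?thesis unfolding m d by simp
qed

lemma koszul_frame:
  "koszul \<kappa> \<tau> (frame i) (frame j) (frame k) q =
     (metric \<kappa> \<tau> q (lie_bracket (frame i) (frame j) q) (frame k q)
      - metric \<kappa> \<tau> q (lie_bracket (frame i) (frame k) q) (frame j q)
      - metric \<kappa> \<tau> q (lie_bracket (frame j) (frame k) q) (frame i q)) / 2"
  unfolding koszul_def metric_frame_derivative by simp

lemma lie_bracket_frame_values:
  "lie_bracket (frame i) (frame i) q = in_frame q 0 0"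
  "lie_bracket (frame 1) (frame 2) q = in_frame q 0 2"
  "lie_bracket (frame 2) (frame 1) q = in_frame q 0 (- 2)"
  "lie_bracket (frame 1) (frame 3) q = in_frame q (2 * \<i>) 0"
  "lie_bracket (frame 3) (frame 1) q = in_frame q (- 2 * \<i>) 0"
  "lie_bracket (frame 2) (frame 3) q = in_frame q (- 2) 0"
  "lie_bracket (frame 3) (frame 2) q = in_frame q 2 0"
  by (simp_all add: lie_bracket_frame, simp_all add: frame_def in_frame_def zero_prod_def)

text \<open>The constant \<mu> is the ratio g(V,V) / g(E^1,E^1). The shift between \<mu> and \<mu> +
  2 is the bracket of V with E^1 or E^2, as vanishing torsion requires.\<close>

lemma levi_civita_frame:
  assumes "q \<in> sl2r" "\<kappa> \<noteq> 0" "\<tau> \<noteq> 0"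
  defines "\<mu> \<equiv> 4 * \<tau>\<^sup>2 / (- \<kappa>)"
  shows "levi_civita \<kappa> \<tau> (frame i) (frame i) q = in_frame q 0 0"
    "levi_civita \<kappa> \<tau> (frame 1) (frame 2) q = in_frame q 0 1"
    "levi_civita \<kappa> \<tau> (frame 2) (frame 1) q = in_frame q 0 (- 1)"
    "levi_civita \<kappa> \<tau> (frame 1) (frame 3) q = in_frame q (- \<i> * of_real \<mu>) 0"
    "levi_civita \<kappa> \<tau> (frame 2) (frame 3) q = in_frame q (of_real \<mu>) 0"
    "levi_civita \<kappa> \<tau> (frame 3) (frame 1) q = in_frame q (- \<i> * of_real (\<mu> + 2)) 0"
    "levi_civita \<kappa> \<tau> (frame 3) (frame 2) q = in_frame q (of_real (\<mu> + 2)) 0"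
proof -
  note s = levi_civita_def koszul_frame frame_sum lie_bracket_frame_values[unfolded frame_simps]
    lie_bracket_frame_values
    metric_eq frame_simps hor_in_frame[OF assms(1)] ver_in_frame[OF assms(1)]
  show "levi_civita \<kappa> \<tau> (frame i) (frame i) q = in_frame q 0 0"
    using exhaust_3[of i] assms(2,3)
    by (auto simp: s Complex_eq)
  show "levi_civita \<kappa> \<tau> (frame 1) (frame 2) q = in_frame q 0 1"
    "levi_civita \<kappa> \<tau> (frame 2) (frame 1) q = in_frame q 0 (- 1)"
    using assms(2,3)
    by (auto simp: s Complex_eq)
  show
    "levi_civita \<kappa> \<tau> (frame 1) (frame 3) q = in_frame q (- \<i> * of_real \<mu>) 0"
    "levi_civita \<kappa> \<tau> (frame 2) (frame 3) q = in_frame q (of_real \<mu>) 0"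
    "levi_civita \<kappa> \<tau> (frame 3) (frame 1) q = in_frame q (- \<i> * of_real (\<mu> + 2)) 0"
    "levi_civita \<kappa> \<tau> (frame 3) (frame 2) q = in_frame q (of_real (\<mu> + 2)) 0"
    using assms(2,3)
    unfolding s \<mu>_def
    by - (rule arg_cong2[where f = "in_frame q"]; simp add: complex_eq_iff field_simps power2_eq_square)+
qed

text \<open>Three corrections join the derivatives of the coefficients: the \<mu> term comes from
  differentiating V in horizontal directions, the \<mu> + 2 term from differentiating E^1 and E^2
  along V, and the \<open>Im\<close> term from the derivatives of E^1 and E^2 along each other,
  which are V and -V.\<close>

lemma cov_deriv_eq:
  fixes F N :: "real ^ 3 \<Rightarrow> c2"
  assumes "\<And>p. p \<in> S2 \<Longrightarrow> F p \<in> sl2r" "\<And>p. p \<in> S2 \<Longrightarrow> N p = in_frame (F p) (n p) (c p)"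
    and "\<kappa> \<noteq> 0" "\<tau> \<noteq> 0" "p \<in> S2" "v \<in> tangent_S2 p"
    and "(n has_derivative n') (at p)" "(c has_derivative c') (at p)"
  defines "\<mu> \<equiv> 4 * \<tau>\<^sup>2 / (- \<kappa>)" and "A \<equiv> hor (F p) (dS2 F p v)" and "\<gamma> \<equiv> ver (F p) (dS2 F p v)"
  shows "cov_deriv \<kappa> \<tau> F N p v =
    in_frame (F p) (n' v - \<i> * of_real (\<mu> * c p) * A - \<i> * of_real ((\<mu> + 2) * \<gamma>) * n p)
      (c' v + Im (cnj A * n p))"
proof -
  have co: "coords (F x) (N x) $ 1 = Re (n x)" "coords (F x) (N x) $ 2 = Im (n x)"
    "coords (F x) (N x) $ 3 = c x" if "x \<in> S2" for x
    using assms(1,2)[OF that] by (simp_all add: coords_nth hor_in_frame ver_in_frame)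
  have d: "dS2 (\<lambda>x. coords (F x) (N x) $ 1) p v = Re (n' v)"
    "dS2 (\<lambda>x. coords (F x) (N x) $ 2) p v = Im (n' v)"
    "dS2 (\<lambda>x. coords (F x) (N x) $ 3) p v = c' v"
    using dS2_cong[OF co(1) assms(5)] dS2_cong[OF co(2) assms(5)] dS2_cong[OF co(3) assms(5)]
      dS2_eq[OF has_derivative_Re[OF assms(7)] assms(5,6)]
      dS2_eq[OF has_derivative_Im[OF assms(7)] assms(5,6)] dS2_eq[OF assms(8,5,6)]
    by simp_all
  note lc = levi_civita_frame[OF assms(1)[OF assms(5)] assms(3,4)]
  show ?thesis
    unfolding cov_deriv_def sum_3
    unfolding d co[OF assms(5)]
    unfolding coords_nth lc
    unfolding frame_simps in_frame_scaleR in_frame_add A_def[symmetric] \<gamma>_def[symmetric] \<mu>_def[symmetric]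
    by (rule arg_cong2[where f = "in_frame (F p)"]) (simp_all add: complex_eq_iff algebra_simps)
qed

section \<open>The surface as a smooth map of the unit sphere\<close>

locale rotational_sphere =
  fixes \<kappa> \<tau> H :: real
  assumes \<kappa>_neg: "\<kappa> < 0" and \<tau>_nz: "\<tau> \<noteq> 0" and H_pos: "H > 0" and H_large: "4 * H\<^sup>2 + \<kappa> > 0"
begin

definition k :: real where "k = sqrt (- \<kappa>)"

definition D :: "real \<Rightarrow> real" where "D h = 4 * H\<^sup>2 + \<kappa> + (4 * \<tau>\<^sup>2 - \<kappa>) * h\<^sup>2"

definition S :: real where "S = H\<^sup>2 + \<tau>\<^sup>2"

definition angle :: "real \<Rightarrow> real" where
  "angle h = H / \<tau> * (sqrt (4 * \<tau>\<^sup>2 - \<kappa>) / sqrt (4 * H\<^sup>2 + \<kappa>))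
     * arctan (sqrt (4 * \<tau>\<^sup>2 - \<kappa>) / sqrt (4 * H\<^sup>2 + \<kappa>) * h)"

definition meridian :: "real \<Rightarrow> complex" where
  "meridian h = (2 / sqrt (D h)) *\<^sub>R (Complex H (- \<tau> * h) * cis (angle h))"

definition horizontal :: "real ^ 3 \<Rightarrow> complex" where "horizontal p = Complex (p $ 1) (p $ 2)"

definition immersion :: "real ^ 3 \<Rightarrow> c2" where
  "immersion p = (meridian (p $ 3), (k / sqrt (D (p $ 3))) *\<^sub>R horizontal p)"

definition normal_hor :: "real ^ 3 \<Rightarrow> complex" where
  "normal_hor p = (- k / 2) *\<^sub>R (cis (angle (p $ 3)) * horizontal p)"

definition normal_ver :: "real ^ 3 \<Rightarrow> real" where
  "normal_ver p = \<kappa> / (4 * \<tau>) * p $ 3"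

definition normal :: "real ^ 3 \<Rightarrow> c2" where
  "normal p = in_frame (immersion p) (normal_hor p) (normal_ver p)"

lemma k_pos: "k > 0" and k_square: "k\<^sup>2 = - \<kappa>"
  using \<kappa>_neg by (simp_all add: k_def)

lemma C_pos: "4 * \<tau>\<^sup>2 - \<kappa> > 0"
  using \<kappa>_neg zero_le_power2[of \<tau>] by linarith

lemma S_pos: "S > 0"
  using H_pos by (simp add: S_def add_pos_nonneg)

text \<open>At the equator h = 0 this is the assumption on 4H^2 + \<kappa> itself. It keeps every
  denominator of the construction away from zero.\<close>

lemma D_pos: "D h > 0"
  unfolding D_def using H_large C_pos by (simp add: add_pos_nonneg)

lemma smooth_S2_horizontal: "smooth_S2 horizontal"
proof -
  have "smooth_S2 (\<lambda>p. of_real (p $ 1) + \<i> * of_real (p $ 2))"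
    by (intro smooth_S2_add smooth_S2_mult smooth_S2_of_real smooth_S2_const smooth_S2_component)
  then show ?thesis by (simp add: horizontal_def[abs_def] Complex_eq)
qed

lemma smooth_S2_angle: "smooth_S2 (\<lambda>p. angle (p $ 3))"
  unfolding angle_def
  by (intro smooth_S2_mult smooth_S2_arctan smooth_S2_const smooth_S2_component)

lemma smooth_S2_inverse_sqrt_D: "smooth_S2 (\<lambda>p. inverse (sqrt (D (p $ 3))))"
proof (intro smooth_S2_inverse smooth_S2_sqrt)
  show "smooth_S2 (\<lambda>p. D (p $ 3))"
    unfolding D_def power2_eq_square[of "_ $ _"]
    by (intro smooth_S2_add smooth_S2_mult smooth_S2_const smooth_S2_component)
  show "D (p $ 3) > 0" "sqrt (D (p $ 3)) \<noteq> 0" for p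
    using D_pos[of "p $ 3"] by simp_all
qed

lemma smooth_S2_immersion: "smooth_S2 immersion"
proof -
  have "smooth_S2 (\<lambda>p. ((2 * inverse (sqrt (D (p $ 3)))) *\<^sub>R
      ((of_real H + \<i> * of_real (- \<tau> * p $ 3)) * cis (angle (p $ 3))),
      (k * inverse (sqrt (D (p $ 3)))) *\<^sub>R horizontal p))"
    by (intro smooth_S2_Pair smooth_S2_bilinear[OF bounded_bilinear_scaleR] smooth_S2_mult smooth_S2_add
        smooth_S2_cis smooth_S2_of_real smooth_S2_const smooth_S2_component smooth_S2_inverse_sqrt_D
        smooth_S2_angle smooth_S2_horizontal)
  then show ?thesis
    by (simp add: immersion_def[abs_def] meridian_def[abs_def] Complex_eq field_simps)
qed

lemma smooth_S2_normal_hor: "smooth_S2 normal_hor"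
  unfolding normal_hor_def[abs_def]
  by (intro smooth_S2_bilinear[OF bounded_bilinear_scaleR] smooth_S2_mult
      smooth_S2_cis smooth_S2_const smooth_S2_angle smooth_S2_horizontal)

lemma smooth_S2_normal: "smooth_S2 normal"
proof -
  have F: "smooth_S2 (\<lambda>p. fst (immersion p))" "smooth_S2 (\<lambda>p. snd (immersion p))"
    by (intro smooth_S2_linear[OF bounded_linear_fst] smooth_S2_linear[OF bounded_linear_snd] smooth_S2_immersion)+
  show ?thesis
    unfolding normal_def[abs_def] in_frame_def normal_ver_def
    by (intro smooth_S2_Pair smooth_S2_add smooth_S2_mult smooth_S2_cnj smooth_S2_of_real
        smooth_S2_const smooth_S2_component smooth_S2_normal_hor F)
qed

text \<open>The two forms in which the equation of the sphere enters: the first gives |z|^2 - |w|^2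
  = 1, the second removes all dependence on the point from the trace.\<close>

lemma D_sphere:
  assumes "r\<^sup>2 + h\<^sup>2 = 1"
  shows "D h = 4 * H\<^sup>2 + 4 * \<tau>\<^sup>2 * h\<^sup>2 - k\<^sup>2 * r\<^sup>2"
    and "D h + (4 * \<tau>\<^sup>2 - \<kappa>) * r\<^sup>2 = 4 * S"
proof -
  have r: "r\<^sup>2 = 1 - h\<^sup>2" using assms by simp
  show "D h = 4 * H\<^sup>2 + 4 * \<tau>\<^sup>2 * h\<^sup>2 - k\<^sup>2 * r\<^sup>2"
    "D h + (4 * \<tau>\<^sup>2 - \<kappa>) * r\<^sup>2 = 4 * S"
    unfolding D_def S_def k_square r by (simp_all add: algebra_simps)
qed

text \<open>The factor c inside the arctangent is such that 1 + c^2 h^2 = D(h) / (4H^2 +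
  \<kappa>).\<close>

lemma angle_derivative:
  "(angle has_real_derivative H * (4 * \<tau>\<^sup>2 - \<kappa>) / (\<tau> * D h)) (at h)"
proof -
  define c where "c = sqrt (4 * \<tau>\<^sup>2 - \<kappa>) / sqrt (4 * H\<^sup>2 + \<kappa>)"
  have c2: "c\<^sup>2 = (4 * \<tau>\<^sup>2 - \<kappa>) / (4 * H\<^sup>2 + \<kappa>)"
    using C_pos H_large by (simp add: c_def power_divide)
  define m where "m = H / \<tau>"
  have a: "angle = (\<lambda>h. m * c * arctan (c * h))"
    by (simp add: angle_def[abs_def] c_def m_def)
  have "(angle has_real_derivative m * c * (c * inverse (1 + (c * h)\<^sup>2))) (at h)"
    unfolding a by (auto intro!: derivative_eq_intros simp: divide_simps)
  also have "m * c * (c * inverse (1 + (c * h)\<^sup>2)) = m * (c\<^sup>2 / (1 + c\<^sup>2 * h\<^sup>2))"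
    by (simp add: power_mult_distrib power2_eq_square divide_inverse)
  also have "c\<^sup>2 / (1 + c\<^sup>2 * h\<^sup>2) = (4 * \<tau>\<^sup>2 - \<kappa>) / D h"
  proof -
    have "1 + C / B * x = (B + C * x) / B" if "B > 0" for B C x :: real
      using that by (simp add: field_simps)
    then show ?thesis
      unfolding c2 D_def using H_large by simp
  qed
  finally show ?thesis by (simp add: m_def)
qed

lemma inverse_sqrt_D_derivative:
  "((\<lambda>h. c / sqrt (D h)) has_real_derivative - c * (4 * \<tau>\<^sup>2 - \<kappa>) * h / (D h * sqrt (D h))) (at h)"
proof -
  have "(D has_real_derivative 2 * (4 * \<tau>\<^sup>2 - \<kappa>) * h) (at h)"
    unfolding D_def[abs_def] by (auto intro!: derivative_eq_intros)
  from DERIV_chain2[where f = sqrt and g = D, OF DERIV_real_sqrt[OF D_pos[of h]] this]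
  have "((\<lambda>h. sqrt (D h)) has_real_derivative inverse (sqrt (D h)) / 2 * (2 * (4 * \<tau>\<^sup>2 - \<kappa>) * h)) (at h)" .
  from DERIV_divide[OF DERIV_const this, of c] D_pos[of h]
  have d: "((\<lambda>h. c / sqrt (D h)) has_real_derivative
      (0 * sqrt (D h) - c * (inverse (sqrt (D h)) / 2 * (2 * (4 * \<tau>\<^sup>2 - \<kappa>) * h))) / (sqrt (D h) * sqrt (D h))) (at h)"
    by simp
  have q: "(0 * s - c * (inverse s / 2 * (2 * C * h))) / (s * s) = - c * C * h / (s * s * s)"
    if "s > 0" for s C :: real
    using that by (simp add: field_simps)
  have s: "sqrt (D h) > 0" "sqrt (D h) * sqrt (D h) = D h" using D_pos[of h] by simp_all
  show ?thesis
    using d unfolding q[OF s(1)] unfolding s(2) .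
qed

lemma cis_angle_derivative:
  "((\<lambda>h. cis (angle h)) has_vector_derivative
     Complex 0 (H * (4 * \<tau>\<^sup>2 - \<kappa>) / (\<tau> * D h)) * cis (angle h)) (at h)"
  unfolding has_vector_derivative_complex_iff
  by (auto intro!: derivative_eq_intros DERIV_chain2[OF angle_derivative])

text \<open>The rate of change of \<omega> cancels the component along \<open>cis (angle h)\<close>,
  so the velocity is a real multiple of i e^{i \<omega>}. This is why the differential below has
  such short coordinates.\<close>

lemma meridian_derivative:
  "(meridian has_vector_derivative
     (2 * k\<^sup>2 * S / (\<tau> * (D h * sqrt (D h)))) *\<^sub>R (\<i> * cis (angle h))) (at h)"
proof -
  have "((\<lambda>h. Complex H (- \<tau> * h)) has_vector_derivative Complex 0 (- \<tau>)) (at h)"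
    unfolding has_vector_derivative_complex_iff by (auto intro!: derivative_eq_intros)
  from has_vector_derivative_scaleR[OF inverse_sqrt_D_derivative[of 2] has_vector_derivative_mult[OF this cis_angle_derivative]]
  have d: "(meridian has_vector_derivative
      (2 / sqrt (D h)) *\<^sub>R (Complex H (- \<tau> * h) * (Complex 0 (H * (4 * \<tau>\<^sup>2 - \<kappa>) / (\<tau> * D h)) * cis (angle h))
         + Complex 0 (- \<tau>) * cis (angle h))
      + (- 2 * (4 * \<tau>\<^sup>2 - \<kappa>) * h / (D h * sqrt (D h))) *\<^sub>R (Complex H (- \<tau> * h) * cis (angle h))) (at h)"
    by (simp add: meridian_def[abs_def])
  have "(2 / sqrt (D h)) *\<^sub>R (Complex H (- \<tau> * h) * Complex 0 (H * (4 * \<tau>\<^sup>2 - \<kappa>) / (\<tau> * D h)) + Complex 0 (- \<tau>))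
      + (- 2 * (4 * \<tau>\<^sup>2 - \<kappa>) * h / (D h * sqrt (D h))) *\<^sub>R Complex H (- \<tau> * h)
      = (2 * k\<^sup>2 * S / (\<tau> * (D h * sqrt (D h)))) *\<^sub>R \<i>" (is "?l = ?r")
  proof (rule complex_eqI)
    show "Re ?l = Re ?r"
      using D_pos[of h] \<tau>_nz by (simp add: field_simps)
    have "(H * H * (4 * \<tau>\<^sup>2 - \<kappa>) / (\<tau> * D h) - \<tau>) + (4 * \<tau>\<^sup>2 - \<kappa>) * h * \<tau> * h / D h = k\<^sup>2 * S / (\<tau> * D h)"
    proof -
      \<comment> \<open>The terms in h^2 cancel, and so do those in \<tau>^2 H^2; what is left is
        -\<kappa> (H^2 + \<tau>^2).\<close>
      have "H * H * (4 * \<tau>\<^sup>2 - \<kappa>) - \<tau> * \<tau> * D h + (4 * \<tau>\<^sup>2 - \<kappa>) * h * \<tau> * h * \<tau> = k\<^sup>2 * S"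
        unfolding D_def S_def k_square by (simp add: algebra_simps power2_eq_square)
      moreover have "(X / (t * d) - t) + Y / d = Z / (t * d)"
        if "X - t * t * d + Y * t = Z" "d > 0" "t \<noteq> 0" for X Y Z t d :: real
        using that by (simp add: divide_simps)
      ultimately show ?thesis
        using D_pos[of h] \<tau>_nz by blast
    qed
    then have "2 / sqrt (D h) * ((H * H * (4 * \<tau>\<^sup>2 - \<kappa>) / (\<tau> * D h) - \<tau>) + (4 * \<tau>\<^sup>2 - \<kappa>) * h * \<tau> * h / D h)
      = 2 / sqrt (D h) * (k\<^sup>2 * S / (\<tau> * D h))" by simp
    then show "Im ?l = Im ?r"
      by (simp add: algebra_simps divide_inverse)
  qed
  then have "(2 / sqrt (D h)) *\<^sub>R (Complex H (- \<tau> * h) * (Complex 0 (H * (4 * \<tau>\<^sup>2 - \<kappa>) / (\<tau> * D h)) * cis (angle h))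
         + Complex 0 (- \<tau>) * cis (angle h))
      + (- 2 * (4 * \<tau>\<^sup>2 - \<kappa>) * h / (D h * sqrt (D h))) *\<^sub>R (Complex H (- \<tau> * h) * cis (angle h))
      = (2 * k\<^sup>2 * S / (\<tau> * (D h * sqrt (D h)))) *\<^sub>R \<i> * cis (angle h)"
    by (metis (no_types, lifting) distrib_right mult.assoc mult_scaleR_left)
  with d show ?thesis by simp
qed

lemma bounded_linear_horizontal: "bounded_linear horizontal"
  unfolding linear_conv_bounded_linear[symmetric]
  by (rule linearI) (simp_all add: horizontal_def complex_eq_iff)

lemmas nth_derivative = bounded_linear_imp_has_derivative[OF bounded_linear_vec_nth]
lemmas horizontal_derivative = bounded_linear_imp_has_derivative[OF bounded_linear_horizontal]

lemma immersion_derivative: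
  "(immersion has_derivative (\<lambda>v.
     (v $ 3 *\<^sub>R ((2 * k\<^sup>2 * S / (\<tau> * (D (p $ 3) * sqrt (D (p $ 3))))) *\<^sub>R (\<i> * cis (angle (p $ 3)))),
      (k / sqrt (D (p $ 3))) *\<^sub>R horizontal v
      + (- k * (4 * \<tau>\<^sup>2 - \<kappa>) * p $ 3 / (D (p $ 3) * sqrt (D (p $ 3))) * v $ 3) *\<^sub>R horizontal p))) (at p)"
  unfolding immersion_def[abs_def]
  by (rule has_derivative_Pair
      has_derivative_compose[OF nth_derivative meridian_derivative[unfolded has_vector_derivative_def]]
      has_derivative_scaleR[OF has_derivative_compose[OF nth_derivative
          inverse_sqrt_D_derivative[unfolded has_field_derivative_def]] horizontal_derivative])+

lemma normal_hor_derivative: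
  "(normal_hor has_derivative (\<lambda>v. (- k / 2) *\<^sub>R
     (cis (angle (p $ 3)) * horizontal v
      + (v $ 3 *\<^sub>R (Complex 0 (H * (4 * \<tau>\<^sup>2 - \<kappa>) / (\<tau> * D (p $ 3))) * cis (angle (p $ 3)))) * horizontal p))) (at p)"
  unfolding normal_hor_def[abs_def]
  by (rule has_derivative_scaleR_right has_derivative_mult horizontal_derivative
      has_derivative_compose[OF nth_derivative cis_angle_derivative[unfolded has_vector_derivative_def]])+

lemma normal_ver_derivative: "(normal_ver has_derivative (\<lambda>v. \<kappa> / (4 * \<tau>) * v $ 3)) (at p)"
  unfolding normal_ver_def[abs_def]
  by (intro has_derivative_mult_right nth_derivative)

end

section \<open>Tangent planes and mean curvature\<close>

text \<open>At a pole r = 0 and any \<theta> would do. The computations that follow never divide by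
  r and hold for whichever \<theta> is chosen, so the poles need no separate treatment.\<close>

lemma (in rotational_sphere) sphere_coordinates:
  assumes "p \<in> S2"
  obtains r \<theta> where "r\<^sup>2 + (p $ 3)\<^sup>2 = 1" "r \<ge> 0" "horizontal p = of_real r * cis \<theta>"
    "p $ 1 = r * cos \<theta>" "p $ 2 = r * sin \<theta>"
proof -
  have n: "(p $ 1)\<^sup>2 + (p $ 2)\<^sup>2 + (p $ 3)\<^sup>2 = 1"
    using assms by (simp add: norm_vec_def L2_set_def sum_3)
  define z where "z = Complex (p $ 1) (p $ 2)"
  have z: "z = of_real (cmod z) * cis (Arg z)"
    using rcis_cmod_Arg[of z] by (simp add: rcis_def)
  then have "p $ 1 = cmod z * cos (Arg z)" "p $ 2 = cmod z * sin (Arg z)"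
    by (simp_all add: complex_eq_iff z_def)
  moreover have "(cmod z)\<^sup>2 + (p $ 3)\<^sup>2 = 1"
    using n by (simp add: cmod_power2 z_def)
  moreover have "horizontal p = z" by (simp add: horizontal_def z_def)
  ultimately show ?thesis using that[of "cmod z" "Arg z"] z norm_ge_zero by metis
qed

context rotational_sphere begin

lemma immersion_in_sl2r:
  assumes "p \<in> S2"
  shows "immersion p \<in> sl2r"
proof -
  obtain r \<theta> where r: "r\<^sup>2 + (p $ 3)\<^sup>2 = 1" "horizontal p = of_real r * cis \<theta>"
    using sphere_coordinates[OF assms] by metis
  have 1: "(cmod (fst (immersion p)))\<^sup>2 = (4 * H\<^sup>2 + 4 * \<tau>\<^sup>2 * (p $ 3)\<^sup>2) / D (p $ 3)"
    using D_pos[of "p $ 3"]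
    by (simp add: immersion_def meridian_def norm_mult power_mult_distrib power_divide cmod_power2 algebra_simps add_divide_distrib)
  have 2: "(cmod (snd (immersion p)))\<^sup>2 = k\<^sup>2 * r\<^sup>2 / D (p $ 3)"
    using D_pos[of "p $ 3"]
    by (simp add: immersion_def r(2) norm_mult power_mult_distrib power_divide)
  have "(cmod (fst (immersion p)))\<^sup>2 - (cmod (snd (immersion p)))\<^sup>2 = D (p $ 3) / D (p $ 3)"
    unfolding 1 2 diff_divide_distrib[symmetric] using D_sphere(1)[OF r(1)] by simp
  then show ?thesis
    using D_pos[of "p $ 3"] by (simp add: sl2r_def split_beta)
qed

text \<open>\<open>x\<close> and \<open>y\<close> are the coordinates in the orthonormal basis of the tangent plane whose images
  are proportional to $i P$ and $2 \tau h P - k r V$, where $P$ is the horizontal unit vector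
  \<open>cis (angle h + \<theta>)\<close>.\<close>

definition coord_a :: "real \<Rightarrow> real \<Rightarrow> real \<Rightarrow> real" where
  "coord_a h x y = H * x + (D h - 4 * H\<^sup>2) / (4 * \<tau>) * y"

definition coord_b :: "real \<Rightarrow> real \<Rightarrow> real \<Rightarrow> real" where
  "coord_b h x y = D h / (4 * S) * (\<tau> * x - H * y)"

text \<open>In the rotated plane the horizontal part of v is u + i a. Orthogonality to p says that
  (u, v_3) is orthogonal to the unit vector (r, h), hence equal to b (-h, r): b is the component
  towards the north and a the one along the parallel.\<close>

lemma tangent_coordinates:
  assumes "r\<^sup>2 + (p $ 3)\<^sup>2 = 1" "p $ 1 = r * cos \<theta>" "p $ 2 = r * sin \<theta>" "v \<in> tangent_S2 p"
  obtains x y where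
    "horizontal v = Complex (- p $ 3 * coord_b (p $ 3) x y) (coord_a (p $ 3) x y) * cis \<theta>"
    "v $ 3 = r * coord_b (p $ 3) x y"
proof -
  define h where "h = p $ 3"
  have rh: "r\<^sup>2 = 1 - h\<^sup>2" using assms(1) by (simp add: h_def)
  define u where "u = cos \<theta> * v $ 1 + sin \<theta> * v $ 2"
  define a where "a = cos \<theta> * v $ 2 - sin \<theta> * v $ 1"
  define b where "b = r * v $ 3 - h * u"
  have t: "r * u + h * v $ 3 = 0"
    using assms(4) by (simp add: tangent_S2_def inner_vec_def sum_3 assms(2,3) u_def h_def algebra_simps)
  have hb: "- h * b = u"
  proof -
    have "- h * b = h\<^sup>2 * u - r * (h * v $ 3)" by (simp add: b_def algebra_simps power2_eq_square)
    also have "h * v $ 3 = - (r * u)" using t by simp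
    also have "h\<^sup>2 * u - r * - (r * u) = (h\<^sup>2 + r\<^sup>2) * u" by (simp add: algebra_simps power2_eq_square)
    finally show ?thesis using rh by simp
  qed
  have rb: "v $ 3 = r * b"
  proof -
    have "r * b = r\<^sup>2 * v $ 3 - h * (r * u)" by (simp add: b_def algebra_simps power2_eq_square)
    also have "r * u = - (h * v $ 3)" using t by simp
    also have "r\<^sup>2 * v $ 3 - h * - (h * v $ 3) = (r\<^sup>2 + h\<^sup>2) * v $ 3" by (simp add: algebra_simps power2_eq_square)
    finally show ?thesis using rh by simp
  qed
  have hv: "horizontal v = Complex u a * cis \<theta>"
  proof -
    have "u * cos \<theta> - a * sin \<theta> = ((sin \<theta>)\<^sup>2 + (cos \<theta>)\<^sup>2) * v $ 1"
      "u * sin \<theta> + a * cos \<theta> = ((sin \<theta>)\<^sup>2 + (cos \<theta>)\<^sup>2) * v $ 2"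
      unfolding u_def a_def by (simp_all only: algebra_simps power2_eq_square)
    then show ?thesis by (simp add: complex_eq_iff horizontal_def)
  qed
  \<comment> \<open>Together with \<open>y\<close>, Cramer's rule for \<open>coord_a\<close> = a and
    \<open>coord_b\<close> = b; the determinant of this system is -D^2 / (16 S).\<close>
  define x where "x = 4 * H / D h * a + 4 * S / (\<tau> * D h) * (1 - 4 * H\<^sup>2 / D h) * b"
  define y where "y = 4 * \<tau> / D h * a - 16 * H * S / (D h)\<^sup>2 * b"
  have "coord_b h x y = b"
  proof -
    have "\<tau> * x - H * y = 4 * S / D h * b"
      using \<tau>_nz D_pos[of h] by (simp add: x_def y_def field_simps power2_eq_square)
    then show ?thesis using S_pos D_pos[of h] by (simp add: coord_b_def)
  qed
  moreover have "coord_a h x y = a"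
  proof -
    have "H * x = 4 * H\<^sup>2 / D h * a + (D h - 4 * H\<^sup>2) * (4 * H * S / (\<tau> * (D h)\<^sup>2)) * b"
      using \<tau>_nz D_pos[of h] by (simp add: x_def field_simps power2_eq_square)
    moreover have "(D h - 4 * H\<^sup>2) / (4 * \<tau>) * y = (D h - 4 * H\<^sup>2) / D h * a - (D h - 4 * H\<^sup>2) * (4 * H * S / (\<tau> * (D h)\<^sup>2)) * b"
      using \<tau>_nz D_pos[of h] by (simp add: y_def divide_simps) (simp add: algebra_simps power2_eq_square)
    moreover have "4 * H\<^sup>2 / D h * a + (D h - 4 * H\<^sup>2) / D h * a = a"
      using D_pos[of h] by (simp add: field_simps)
    ultimately show ?thesis by (simp add: coord_a_def)
  qed
  ultimately show ?thesis
    using that[of x y] hb rb hv by (simp add: h_def)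
qed

text \<open>Both parts become short once b is replaced by T = \<tau> x - H y with 4 S b = D T: the
  common phase P of both horizontal basis vectors splits off, and x and y remain as plain
  coefficients.\<close>

lemma differential_coords:
  assumes "p \<in> S2" "v \<in> tangent_S2 p"
    and "r\<^sup>2 + (p $ 3)\<^sup>2 = 1" "horizontal p = of_real r * cis \<theta>"
    and hv: "horizontal v = Complex (- p $ 3 * coord_b (p $ 3) x y) (coord_a (p $ 3) x y) * cis \<theta>"
    and v3: "v $ 3 = r * coord_b (p $ 3) x y"
  shows "hor (immersion p) (dS2 immersion p v) = (k / 2) *\<^sub>R (Complex (p $ 3 * y) x * (cis (angle (p $ 3)) * cis \<theta>))"
    and "ver (immersion p) (dS2 immersion p v) = - k\<^sup>2 * r / (4 * \<tau>) * y"
proof -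
  define h where "h = p $ 3"
  define s where "s = sqrt (D h)"
  define a where "a = coord_a h x y"
  define b where "b = coord_b h x y"
  define E where "E = cis (angle h)"
  define e where "e = cis \<theta>"
  define C where "C = 4 * \<tau>\<^sup>2 - \<kappa>"
  define T where "T = \<tau> * x - H * y"
  note defs = h_def[symmetric] s_def[symmetric] a_def[symmetric] b_def[symmetric]
    E_def[symmetric] e_def[symmetric] C_def[symmetric]
  have s: "s > 0" "s * s = D h" using D_pos[of h] by (simp_all add: s_def)
  have Dh: "D h > 0" by (rule D_pos)
  have Db: "4 * S * b = D h * T"
    using S_pos by (simp add: b_def coord_b_def T_def)
  have Ds: "D h = 4 * H\<^sup>2 + 4 * \<tau>\<^sup>2 * h\<^sup>2 - k\<^sup>2 * r\<^sup>2" "D h + C * r\<^sup>2 = 4 * S"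
    using D_sphere[OF assms(3)] by (simp_all add: C_def h_def)
  have a4: "4 * \<tau> * a = 4 * \<tau> * H * x + (D h - 4 * H\<^sup>2) * y"
    using \<tau>_nz by (simp add: a_def coord_a_def field_simps)
  have z: "fst (immersion p) = (2 / s) *\<^sub>R (Complex H (- \<tau> * h) * E)"
    by (simp add: immersion_def meridian_def defs)
  have w: "snd (immersion p) = (k * r / s) *\<^sub>R e"
    by (simp add: immersion_def assms(4) defs scaleR_conv_of_real)
  have U: "dS2 immersion p v = (
      (v $ 3 * (2 * k\<^sup>2 * S / (\<tau> * (D h * s)))) *\<^sub>R (\<i> * E),
      (k / s) *\<^sub>R horizontal v + (- k * C * h / (D h * s) * v $ 3) *\<^sub>R horizontal p)"
    using dS2_eq[OF immersion_derivative assms(1,2)] unfolding defs by simp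
  have "r * b * (2 * k\<^sup>2 * S / (\<tau> * (D h * s))) = k\<^sup>2 * r / (2 * \<tau> * s) * (4 * S * b / D h)"
    by (simp add: field_simps)
  also have "4 * S * b / D h = T" using Db Dh by (simp add: field_simps)
  finally have U1: "fst (dS2 immersion p v) = (k\<^sup>2 * r / (2 * \<tau> * s) * T) *\<^sub>R (\<i> * E)"
    unfolding U v3 defs by simp
  \<comment> \<open>Differentiating 1 / sqrt D contributes C r^2 next to D; their sum 4S turns b
    into T.\<close>
  have "- h * b / s - C * h / (D h * s) * (r * b) * r = - h / s * ((D h + C * r\<^sup>2) * b / D h)"
    using Dh s by (simp add: field_simps power2_eq_square)
  also have "(D h + C * r\<^sup>2) * b / D h = T"
    unfolding Ds(2) using Db Dh by (simp add: field_simps)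
  finally have hb: "- h * b / s - C * h / (D h * s) * (r * b) * r = - h / s * T" .
  have U2: "snd (dS2 immersion p v) = (k / s) *\<^sub>R (Complex (- h * T) a * e)"
  proof -
    have "snd (dS2 immersion p v) = k *\<^sub>R (Complex (- h * b / s - C * h / (D h * s) * (r * b) * r) (a / s) * e)"
      unfolding U v3 hv assms(4) defs
      by (simp add: scaleR_conv_of_real complex_eq_iff algebra_simps add_divide_distrib diff_divide_distrib)
    then show ?thesis unfolding hb
      by (simp add: scaleR_conv_of_real complex_eq_iff algebra_simps diff_divide_distrib)
  qed
  \<comment> \<open>This is z U_2 - w U_1 without its phase and the scalar k / D. Inserting a and T
    in terms of x and y cancels everything but a multiple of h y + i x.\<close>
  have coeff: "2 * (Complex H (- \<tau> * h) * Complex (- h * T) a) - Complex 0 (k\<^sup>2 * r\<^sup>2 / (2 * \<tau>) * T)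
      = (D h / 2) *\<^sub>R Complex (h * y) x"
  proof (rule complex_eqI)
    have "2 * (\<tau> * h * a - H * h * T) = h / 2 * (4 * \<tau> * a - 4 * H * T)"
      by (simp add: algebra_simps)
    also have "\<dots> = D h / 2 * (h * y)"
      unfolding a4 T_def by (simp add: algebra_simps power2_eq_square)
    finally show "Re (2 * (Complex H (- \<tau> * h) * Complex (- h * T) a) - Complex 0 (k\<^sup>2 * r\<^sup>2 / (2 * \<tau>) * T))
      = Re ((D h / 2) *\<^sub>R Complex (h * y) x)" by (simp add: algebra_simps)
    have "2 * (H * a + \<tau> * h * h * T) - k\<^sup>2 * r\<^sup>2 / (2 * \<tau>) * T
        = (H * (4 * \<tau> * a) + (4 * \<tau>\<^sup>2 * h\<^sup>2 - k\<^sup>2 * r\<^sup>2) * T) / (2 * \<tau>)"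
      using \<tau>_nz by (simp add: divide_simps) (simp add: algebra_simps power2_eq_square)
    also have "4 * \<tau>\<^sup>2 * h\<^sup>2 - k\<^sup>2 * r\<^sup>2 = D h - 4 * H\<^sup>2" using Ds(1) by simp
    also have "(H * (4 * \<tau> * a) + (D h - 4 * H\<^sup>2) * T) / (2 * \<tau>) = D h / 2 * x"
      unfolding a4 T_def using \<tau>_nz by (simp add: field_simps power2_eq_square)
    finally show "Im (2 * (Complex H (- \<tau> * h) * Complex (- h * T) a) - Complex 0 (k\<^sup>2 * r\<^sup>2 / (2 * \<tau>) * T))
      = Im ((D h / 2) *\<^sub>R Complex (h * y) x)" by (simp add: algebra_simps)
  qed
  have "hor (immersion p) (dS2 immersion p v) = (k / (s * s)) *\<^sub>R
      ((2 * (Complex H (- \<tau> * h) * Complex (- h * T) a) - Complex 0 (k\<^sup>2 * r\<^sup>2 / (2 * \<tau>) * T)) * (E * e))"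
  proof -
    have i: "Complex 0 (k\<^sup>2 * r\<^sup>2 / (2 * \<tau>) * T) = of_real (k\<^sup>2 * r\<^sup>2 / (2 * \<tau>) * T) * \<i>"
      by (simp add: complex_eq_iff)
    show ?thesis
      unfolding hor_def z w U1 U2 i using s(1) \<tau>_nz
      by (simp add: scaleR_conv_of_real field_simps power2_eq_square)
  qed
  then show "hor (immersion p) (dS2 immersion p v) = (k / 2) *\<^sub>R (Complex (p $ 3 * y) x * (cis (angle (p $ 3)) * cis \<theta>))"
    unfolding coeff s(2) defs using Dh by (simp add: scaleR_conv_of_real)
  have cE: "E * cnj E = 1" "e * cnj e = 1" by (simp_all add: E_def e_def cis_cnj cis_mult)
  have 1: "cnj (fst (immersion p)) * fst (dS2 immersion p v)
      = of_real (k\<^sup>2 * r / (\<tau> * (s * s)) * T) * (\<i> * Complex H (\<tau> * h)) * (E * cnj E)"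
    unfolding z U1 using s(1) \<tau>_nz by (simp add: scaleR_conv_of_real field_simps power2_eq_square complex_cnj)
  have 2: "cnj (snd (immersion p)) * snd (dS2 immersion p v)
      = of_real (k\<^sup>2 * r / (s * s)) * Complex (- h * T) a * (e * cnj e)"
    unfolding w U2 using s(1) by (simp add: scaleR_conv_of_real field_simps power2_eq_square)
  have "ver (immersion p) (dS2 immersion p v) = k\<^sup>2 * r / (\<tau> * (s * s)) * T * H - k\<^sup>2 * r / (s * s) * a"
    unfolding ver_def 1 2 cE by simp
  also have "\<dots> = k\<^sup>2 * r / (4 * \<tau> * D h) * (4 * H * T - 4 * \<tau> * a)"
    unfolding s(2) using Dh \<tau>_nz by (simp add: field_simps)
  also have "4 * H * T - 4 * \<tau> * a = - D h * y"
    unfolding a4 T_def by (simp add: algebra_simps power2_eq_square)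
  finally show "ver (immersion p) (dS2 immersion p v) = - k\<^sup>2 * r / (4 * \<tau>) * y"
    using Dh by simp
qed

section \<open>Induced metric and unit normal\<close>

lemma \<kappa>_square: "\<kappa>\<^sup>2 = k ^ 4"
proof -
  have "\<kappa>\<^sup>2 = (- \<kappa>)\<^sup>2" by simp
  also have "\<dots> = k ^ 4" unfolding k_square[symmetric] power_mult[symmetric] by simp
  finally show ?thesis .
qed

lemma cis_unit: "cnj (cis s * cis t) * (cis s * cis t) = 1"
  by (simp add: cis_cnj cis_mult)

lemma unit_scale: "cnj P * P = 1 \<Longrightarrow> Re (cnj (a *\<^sub>R (X * P)) * (b *\<^sub>R (Y * P))) = a * b * Re (cnj X * Y)"
proof -
  assume "cnj P * P = 1"
  moreover have "cnj (a *\<^sub>R (X * P)) * (b *\<^sub>R (Y * P)) = (a * b) *\<^sub>R (cnj X * Y * (cnj P * P))"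
    by (simp add: scaleR_conv_of_real)
  ultimately show ?thesis by simp
qed

text \<open>The product y y' gets the weight h^2 from the horizontal and r^2 from the vertical part,
  together 1. Hence the coordinates x, y are Euclidean for the induced metric.\<close>

lemma induced_metric:
  assumes "r\<^sup>2 + h\<^sup>2 = 1" "cnj P * P = 1"
    and "hor q U = (k / 2) *\<^sub>R (Complex (h * y) x * P)" "ver q U = - k\<^sup>2 * r / (4 * \<tau>) * y"
    and "hor q W = (k / 2) *\<^sub>R (Complex (h * y') x' * P)" "ver q W = - k\<^sup>2 * r / (4 * \<tau>) * y'"
  shows "metric \<kappa> \<tau> q U W = x * x' + y * y'"
proof -
  note K = k_square[symmetric] \<kappa>_square
  have 1: "4 / (- \<kappa>) * Re (cnj (hor q U) * hor q W) = h\<^sup>2 * (y * y') + x * x'"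
    unfolding assms(3,5) unit_scale[OF assms(2)] K using k_pos
    by (simp add: power2_eq_square algebra_simps)
  have 2: "16 * \<tau>\<^sup>2 / \<kappa>\<^sup>2 * (ver q U * ver q W) = r\<^sup>2 * (y * y')"
    unfolding assms(4,6) K using k_pos \<tau>_nz
    by (simp add: field_simps power2_eq_square eval_nat_numeral)
  have "h\<^sup>2 * (y * y') + r\<^sup>2 * (y * y') = (r\<^sup>2 + h\<^sup>2) * (y * y')" by (simp add: algebra_simps)
  then show ?thesis unfolding metric_eq 1 2 assms(1) by simp
qed

text \<open>In the plane spanned by P and V, measured in the unit vectors with coefficients k/2 and
  k^2 / (4 \<tau>), the second tangent basis vector is (h, -r) and the normal is (-r, -h), a quarter
  turn away. The first basis vector points along i P and is orthogonal to this plane.\<close>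

lemma normal_unit: "unit_normal \<kappa> \<tau> immersion normal"
  unfolding unit_normal_def
proof (intro conjI ballI)
  show "smooth_S2 normal" by (rule smooth_S2_normal)
  fix p assume p: "p \<in> S2"
  show "normal p \<in> tangent (immersion p)" unfolding normal_def by (rule in_frame_tangent)
  obtain r \<theta> where r: "r\<^sup>2 + (p $ 3)\<^sup>2 = 1" "horizontal p = of_real r * cis \<theta>"
    "p $ 1 = r * cos \<theta>" "p $ 2 = r * sin \<theta>"
    using sphere_coordinates[OF p] by metis
  define h where "h = p $ 3"
  define P where "P = cis (angle h) * cis \<theta>"
  have PP: "cnj P * P = 1" unfolding P_def by (rule cis_unit)
  have hn: "hor (immersion p) (normal p) = (k / 2) *\<^sub>R (Complex (- r) 0 * P)"
    unfolding normal_def hor_in_frame[OF immersion_in_sl2r[OF p]] normal_hor_def r(2) P_def h_def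
    by (simp add: complex_eq_iff algebra_simps)
  have vn: "ver (immersion p) (normal p) = \<kappa> / (4 * \<tau>) * h"
    unfolding normal_def ver_in_frame[OF immersion_in_sl2r[OF p]] normal_ver_def h_def ..
  note K = k_square[symmetric] \<kappa>_square
  have "4 / (- \<kappa>) * Re (cnj (hor (immersion p) (normal p)) * hor (immersion p) (normal p)) = r\<^sup>2"
    unfolding hn unit_scale[OF PP] K using k_pos by (simp add: power2_eq_square)
  moreover have "16 * \<tau>\<^sup>2 / \<kappa>\<^sup>2 * (ver (immersion p) (normal p) * ver (immersion p) (normal p)) = h\<^sup>2"
    unfolding vn using \<kappa>_neg \<tau>_nz by (simp add: power2_eq_square)
  ultimately show "metric \<kappa> \<tau> (immersion p) (normal p) (normal p) = 1"
    unfolding metric_eq using r(1) by (simp add: h_def)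
  fix v assume v: "v \<in> tangent_S2 p"
  obtain x y where xy:
    "horizontal v = Complex (- p $ 3 * coord_b (p $ 3) x y) (coord_a (p $ 3) x y) * cis \<theta>"
    "v $ 3 = r * coord_b (p $ 3) x y"
    using tangent_coordinates[OF r(1,3,4) v] by metis
  note dc = differential_coords[OF p v r(1,2) xy, folded h_def, folded P_def]
  have "4 / (- \<kappa>) * Re (cnj (hor (immersion p) (normal p)) * hor (immersion p) (dS2 immersion p v)) = - r * h * y"
    unfolding hn dc(1) unit_scale[OF PP] K using k_pos by (simp add: power2_eq_square)
  moreover have "16 * \<tau>\<^sup>2 / \<kappa>\<^sup>2 * (ver (immersion p) (normal p) * ver (immersion p) (dS2 immersion p v)) = r * h * y"
    unfolding vn dc(2) using \<kappa>_neg \<tau>_nz K(1)[symmetric] by (simp add: power2_eq_square)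
  ultimately show "metric \<kappa> \<tau> (immersion p) (normal p) (dS2 immersion p v) = 0"
    unfolding metric_eq by simp
qed

section \<open>Second fundamental form and its trace\<close>

lemma second_fundamental_form_eq:
  assumes p: "p \<in> S2" and v: "v \<in> tangent_S2 p"
    and r: "r\<^sup>2 + (p $ 3)\<^sup>2 = 1" "horizontal p = of_real r * cis \<theta>"
    and hv: "horizontal v = Complex (- p $ 3 * coord_b (p $ 3) x y) (coord_a (p $ 3) x y) * cis \<theta>"
    and v3: "v $ 3 = r * coord_b (p $ 3) x y"
  defines "\<mu> \<equiv> 4 * \<tau>\<^sup>2 / (- \<kappa>)"
  shows "second_fundamental_form \<kappa> \<tau> immersion normal p v v =
     coord_a (p $ 3) x y * x - coord_b (p $ 3) x y * y
     + H * (4 * \<tau>\<^sup>2 - \<kappa>) * r\<^sup>2 / (\<tau> * D (p $ 3)) * coord_b (p $ 3) x y * x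
     + ((\<mu> + 2) * k\<^sup>2 / (4 * \<tau>) + \<tau>) * r\<^sup>2 * x * y"
proof -
  define h where "h = p $ 3"
  define a where "a = coord_a h x y"
  define b where "b = coord_b h x y"
  define P where "P = cis (angle h) * cis \<theta>"
  \<comment> \<open>The derivative of \<open>angle\<close> at h. Next, \<open>c\<close> and
    \<open>\<gamma>\<close> are the vertical coefficients of the normal and of the differential;
    \<open>G1\<close> and \<open>G2\<close> are the components along P and i P of the covariant
    derivative of the normal, in units of k/2.\<close>
  define w where "w = H * (4 * \<tau>\<^sup>2 - \<kappa>) / (\<tau> * D h)"
  define c where "c = \<kappa> / (4 * \<tau>) * h"
  define \<gamma> where "\<gamma> = - k\<^sup>2 * r / (4 * \<tau>) * y"
  define G1 where "G1 = h * b + \<mu> * c * x"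
  define G2 where "G2 = - (a + w * r\<^sup>2 * b) - \<mu> * c * h * y + (\<mu> + 2) * \<gamma> * r"
  note K = k_square[symmetric] \<kappa>_square
  note sl = immersion_in_sl2r[OF p]
  have PP: "cnj P * P = 1" unfolding P_def by (rule cis_unit)
  note dc = differential_coords[OF p v r(1,2) hv v3, folded h_def, folded P_def, folded \<gamma>_def]
  have n: "normal_hor p = (k / 2) *\<^sub>R (Complex (- r) 0 * P)"
    unfolding normal_hor_def r(2) P_def h_def by (simp add: complex_eq_iff algebra_simps)
  have n': "(- k / 2) *\<^sub>R (cis (angle (p $ 3)) * horizontal v
      + (v $ 3 *\<^sub>R (Complex 0 (H * (4 * \<tau>\<^sup>2 - \<kappa>) / (\<tau> * D (p $ 3))) * cis (angle (p $ 3)))) * horizontal p)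
      = (- k / 2) *\<^sub>R (Complex (- h * b) (a + w * r\<^sup>2 * b) * P)"
  proof -
    have "Complex (- h * b) (a + w * r\<^sup>2 * b) = Complex (- h * b) a + of_real (r * b) * Complex 0 w * of_real r"
      by (simp add: complex_eq_iff power2_eq_square)
    then show ?thesis
      unfolding hv v3 r(2) h_def[symmetric] a_def[symmetric] b_def[symmetric] w_def[symmetric] P_def
      by (simp only: scaleR_conv_of_real) (simp only: algebra_simps)
  qed
  have cov: "cov_deriv \<kappa> \<tau> immersion normal p v = in_frame (immersion p)
      ((- k / 2) *\<^sub>R (Complex (- h * b) (a + w * r\<^sup>2 * b) * P)
        - \<i> * of_real (\<mu> * c) * ((k / 2) *\<^sub>R (Complex (h * y) x * P))
        - \<i> * of_real ((\<mu> + 2) * \<gamma>) * ((k / 2) *\<^sub>R (Complex (- r) 0 * P)))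
      (\<kappa> / (4 * \<tau>) * v $ 3 + Im (cnj ((k / 2) *\<^sub>R (Complex (h * y) x * P)) * ((k / 2) *\<^sub>R (Complex (- r) 0 * P))))"
    using cov_deriv_eq[OF immersion_in_sl2r normal_def _ \<tau>_nz p v normal_hor_derivative normal_ver_derivative, of \<kappa>]
      \<kappa>_neg unfolding n' dc n by (simp add: normal_ver_def \<mu>_def c_def h_def)
  have hc: "hor (immersion p) (cov_deriv \<kappa> \<tau> immersion normal p v) = (k / 2) *\<^sub>R (Complex G1 G2 * P)"
  proof -
    have "Complex G1 G2 = - Complex (- h * b) (a + w * r\<^sup>2 * b) - \<i> * of_real (\<mu> * c) * Complex (h * y) x
        - \<i> * of_real ((\<mu> + 2) * \<gamma>) * Complex (- r) 0"
      by (simp add: complex_eq_iff G1_def G2_def algebra_simps)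
    moreover have "(- k / 2) *\<^sub>R (X * P) - \<i> * s * ((k / 2) *\<^sub>R (Y * P)) - \<i> * t * ((k / 2) *\<^sub>R (Z * P))
        = (k / 2) *\<^sub>R ((- X - \<i> * s * Y - \<i> * t * Z) * P)" for X Y Z s t
      by (simp add: scaleR_conv_of_real algebra_simps)
    ultimately show ?thesis
      unfolding cov hor_in_frame[OF sl] by (simp only:)
  qed
  have "cnj ((k / 2) *\<^sub>R (Complex (h * y) x * P)) * ((k / 2) *\<^sub>R (Complex (- r) 0 * P))
      = of_real (k\<^sup>2 / 4) * (cnj (Complex (h * y) x) * Complex (- r) 0) * (cnj P * P)"
    by (simp add: scaleR_conv_of_real power2_eq_square)
  then have vc: "ver (immersion p) (cov_deriv \<kappa> \<tau> immersion normal p v) = - k\<^sup>2 * r * b / (4 * \<tau>) + k\<^sup>2 / 4 * (r * x)"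
    unfolding cov ver_in_frame[OF sl] PP v3 b_def h_def using k_square by (simp add: mult_ac)
  have "4 / (- \<kappa>) * Re (cnj (hor (immersion p) (cov_deriv \<kappa> \<tau> immersion normal p v)) * hor (immersion p) (dS2 immersion p v))
      = G1 * h * y + G2 * x"
    unfolding hc dc(1) unit_scale[OF PP] K using k_pos by (simp add: power2_eq_square algebra_simps)
  moreover have "16 * \<tau>\<^sup>2 / \<kappa>\<^sup>2 * (ver (immersion p) (cov_deriv \<kappa> \<tau> immersion normal p v) * ver (immersion p) (dS2 immersion p v))
      = r\<^sup>2 * b * y - \<tau> * r\<^sup>2 * x * y"
    unfolding vc dc(2) \<gamma>_def K using k_pos \<tau>_nz by (simp add: field_simps power2_eq_square eval_nat_numeral)
  ultimately have "second_fundamental_form \<kappa> \<tau> immersion normal p v v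
      = - (G1 * h * y + G2 * x + (r\<^sup>2 * b * y - \<tau> * r\<^sup>2 * x * y))"
    unfolding second_fundamental_form_def metric_eq by simp
  \<comment> \<open>The \<mu> c terms of \<open>G1\<close> and \<open>G2\<close> cancel, and the
    shares h^2 and r^2 of b y combine through the equation of the sphere.\<close>
  also have "\<dots> = a * x + w * r\<^sup>2 * b * x - (\<mu> + 2) * \<gamma> * r * x - (r\<^sup>2 + h\<^sup>2) * b * y + \<tau> * r\<^sup>2 * x * y"
    unfolding G1_def G2_def by (simp add: algebra_simps power2_eq_square)
  also have "(\<mu> + 2) * \<gamma> * r * x = - ((\<mu> + 2) * k\<^sup>2 / (4 * \<tau>)) * r\<^sup>2 * x * y"
    unfolding \<gamma>_def by (simp add: power2_eq_square)
  also have "r\<^sup>2 + h\<^sup>2 = 1" using r(1) by (simp add: h_def)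
  finally show ?thesis
    unfolding h_def[symmetric] a_def[symmetric] b_def[symmetric] by (simp add: w_def algebra_simps)
qed

text \<open>In the Euclidean coordinates the pair v, u forms the rows of an orthogonal matrix, so
  its columns are orthonormal too. The sum of the two diagonal values is therefore the trace of a
  quadratic form in x, y.\<close>

lemma mean_curvature:
  assumes p: "p \<in> S2" and o: "orthonormal_pair \<kappa> \<tau> immersion p v u"
  shows "second_fundamental_form \<kappa> \<tau> immersion normal p v v + second_fundamental_form \<kappa> \<tau> immersion normal p u u = 2 * H"
proof -
  have "v \<in> tangent_S2 p" "u \<in> tangent_S2 p" using o by (simp_all add: orthonormal_pair_def)
  note vu = this
  obtain r \<theta> where r: "r\<^sup>2 + (p $ 3)\<^sup>2 = 1" "horizontal p = of_real r * cis \<theta>"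
    "p $ 1 = r * cos \<theta>" "p $ 2 = r * sin \<theta>"
    using sphere_coordinates[OF p] by metis
  define h where "h = p $ 3"
  obtain x y where xy:
    "horizontal v = Complex (- p $ 3 * coord_b (p $ 3) x y) (coord_a (p $ 3) x y) * cis \<theta>"
    "v $ 3 = r * coord_b (p $ 3) x y"
    using tangent_coordinates[OF r(1,3,4) vu(1)] by metis
  obtain x' y' where xy':
    "horizontal u = Complex (- p $ 3 * coord_b (p $ 3) x' y') (coord_a (p $ 3) x' y') * cis \<theta>"
    "u $ 3 = r * coord_b (p $ 3) x' y'"
    using tangent_coordinates[OF r(1,3,4) vu(2)] by metis
  note dv = differential_coords[OF p vu(1) r(1,2) xy]
  note du = differential_coords[OF p vu(2) r(1,2) xy']
  note m = induced_metric[OF r(1) cis_unit]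
  have o1: "x * x + y * y = 1" "x' * x' + y' * y' = 1" "x * x' + y * y' = 0"
    using o m[OF dv dv] m[OF du du] m[OF dv du] by (simp_all add: orthonormal_pair_def)
  \<comment> \<open>The determinant of the orthogonal matrix: the first row is the second one turned
    by a quarter and multiplied by d, and d^2 = 1.\<close>
  define d where "d = x * y' - x' * y"
  have "x = x * (x' * x' + y' * y') - x' * (x * x' + y * y')" unfolding o1 by simp
  also have "\<dots> = y' * d" by (simp add: d_def algebra_simps)
  finally have x: "x = y' * d" .
  have "y = y * (x' * x' + y' * y') - y' * (x * x' + y * y')" unfolding o1 by simp
  also have "\<dots> = - x' * d" by (simp add: d_def algebra_simps)
  finally have y: "y = - x' * d" .
  have "x * x + y * y = (x' * x' + y' * y') * (d * d)" unfolding x y by (simp add: algebra_simps)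
  then have d: "d * d = 1" unfolding o1 by simp
  have "x * x + x' * x' = (y' * y') * (d * d) + x' * x'" "y * y + y' * y' = (x' * x') * (d * d) + y' * y'"
    "x * y + x' * y' = - (x' * y') * (d * d) + x' * y'"
    unfolding x y by (simp_all add: algebra_simps)
  then have t: "x * x + x' * x' = 1" "y * y + y' * y' = 1" "x * y + x' * y' = 0"
    unfolding d using o1(2) by simp_all
  define C where "C = 4 * \<tau>\<^sup>2 - \<kappa>"
  define \<mu> where "\<mu> = 4 * \<tau>\<^sup>2 / (- \<kappa>)"
  \<comment> \<open>The coefficient of the mixed product, which drops out of the trace.\<close>
  define \<beta> where "\<beta> = (D h - 4 * H\<^sup>2) / (4 * \<tau>) - D h * \<tau> / (4 * S) - H * C * r\<^sup>2 * H / (4 * S * \<tau>)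
    + ((\<mu> + 2) * k\<^sup>2 / (4 * \<tau>) + \<tau>) * r\<^sup>2"
  have q: "coord_a h X Y * X - coord_b h X Y * Y + H * C * r\<^sup>2 / (\<tau> * D h) * coord_b h X Y * X
      + ((\<mu> + 2) * k\<^sup>2 / (4 * \<tau>) + \<tau>) * r\<^sup>2 * X * Y
      = (H + H * C * r\<^sup>2 / (4 * S)) * (X * X) + H * D h / (4 * S) * (Y * Y) + \<beta> * (X * Y)" for X Y
  proof -
    have "H * C * r\<^sup>2 / (\<tau> * D h) * coord_b h X Y = H * C * r\<^sup>2 / (4 * S) * X - H * C * r\<^sup>2 * H / (4 * S * \<tau>) * Y"
      unfolding coord_b_def using D_pos[of h] S_pos \<tau>_nz by (simp add: field_simps)
    moreover have "coord_b h X Y = D h * \<tau> / (4 * S) * X - H * D h / (4 * S) * Y"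
      unfolding coord_b_def by (simp add: algebra_simps diff_divide_distrib)
    ultimately show ?thesis
      unfolding coord_a_def \<beta>_def by (simp only:) (simp only: algebra_simps)
  qed
  note II = second_fundamental_form_eq[OF p _ r(1,2), folded h_def, folded C_def, folded \<mu>_def, unfolded q]
  have "second_fundamental_form \<kappa> \<tau> immersion normal p v v + second_fundamental_form \<kappa> \<tau> immersion normal p u u
     = (H + H * C * r\<^sup>2 / (4 * S)) * (x * x + x' * x') + H * D h / (4 * S) * (y * y + y' * y') + \<beta> * (x * y + x' * y')"
    unfolding II[OF vu(1) xy[folded h_def]] II[OF vu(2) xy'[folded h_def]] by (simp only: algebra_simps)
  also have "\<dots> = H + H * (D h + C * r\<^sup>2) / (4 * S)"
    unfolding t by (simp add: algebra_simps add_divide_distrib)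
  also have "D h + C * r\<^sup>2 = 4 * S"
    unfolding C_def h_def by (rule D_sphere(2)[OF r(1)])
  finally show ?thesis using S_pos by simp
qed

lemma immersion_sphere_immersion: "sphere_immersion immersion"
  unfolding sphere_immersion_def
proof (intro conjI ballI)
  show "immersion ` S2 \<subseteq> sl2r" using immersion_in_sl2r by auto
  show "smooth_S2 immersion" by (rule smooth_S2_immersion)
  fix p assume p: "p \<in> S2"
  obtain r \<theta> where r: "r\<^sup>2 + (p $ 3)\<^sup>2 = 1" "horizontal p = of_real r * cis \<theta>"
    "p $ 1 = r * cos \<theta>" "p $ 2 = r * sin \<theta>"
    using sphere_coordinates[OF p] by metis
  obtain f' where f': "(immersion has_derivative f') (at p)" using immersion_derivative by blast
  note d = dS2_eq[OF f' p] and lin = has_derivative_linear[OF f']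
  show "inj_on (dS2 immersion p) (tangent_S2 p)"
  proof (rule inj_onI)
    fix u u' assume u: "u \<in> tangent_S2 p" "u' \<in> tangent_S2 p" "dS2 immersion p u = dS2 immersion p u'"
    define v where "v = u - u'"
    have v: "v \<in> tangent_S2 p" using u(1,2) by (simp add: v_def tangent_S2_def inner_diff_left)
    have "dS2 immersion p v = 0"
      using u d v linear_diff[OF lin, of u u'] by (simp add: v_def)
    then have z: "hor (immersion p) (dS2 immersion p v) = 0" "ver (immersion p) (dS2 immersion p v) = 0"
      by (simp_all add: hor_def ver_def)
    obtain x y where xy:
      "horizontal v = Complex (- p $ 3 * coord_b (p $ 3) x y) (coord_a (p $ 3) x y) * cis \<theta>"
      "v $ 3 = r * coord_b (p $ 3) x y"
      using tangent_coordinates[OF r(1,3,4) v] by metis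
    note dv = differential_coords[OF p v r(1,2) xy]
    have "x * x + y * y = 0"
      using induced_metric[OF r(1) cis_unit dv dv] by (simp add: metric_eq z)
    then have "x = 0" "y = 0" by (simp_all add: sum_squares_eq_zero_iff)
    then have "horizontal v = 0" "v $ 3 = 0"
      using xy by (simp_all add: coord_a_def coord_b_def zero_complex.code[symmetric])
    then have "v = 0" by (simp add: horizontal_def vec_eq_iff forall_3 complex_eq_iff)
    then show "u = u'" by (simp add: v_def)
  qed
qed

lemma immersion_cmc: "cmc_sphere_immersion \<kappa> \<tau> H immersion"
  unfolding cmc_sphere_immersion_def
  using immersion_sphere_immersion normal_unit mean_curvature by (intro conjI exI[of _ normal]) auto

end

section \<open>The profile curve\<close>

lemma tanh_artanh_real:
  fixes c :: real
  assumes "\<bar>c\<bar> < 1"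
  shows "tanh (artanh c) = c"
proof -
  have "exp (- 2 * artanh c) = inverse ((1 + c) / (1 - c))"
    using assms by (simp add: artanh_def exp_minus)
  then have e: "exp (- 2 * artanh c) = (1 - c) / (1 + c)" by simp
  show ?thesis
    unfolding tanh_real_altdef e using assms by (simp add: field_simps)
qed

context rotational_sphere begin

abbreviation a :: real where "a \<equiv> half_length \<kappa> H"
abbreviation \<rho> :: "real \<Rightarrow> real" where "\<rho> \<equiv> prof_rho \<kappa> \<tau> H"
abbreviation y :: "real \<Rightarrow> real" where "y \<equiv> prof_y \<kappa> \<tau> H"

lemma k_less: "k < 2 * H"
proof -
  have "k\<^sup>2 < (2 * H)\<^sup>2" unfolding k_square using H_large by (simp add: power2_eq_square)
  then show ?thesis by (rule power2_less_imp_less) (use H_pos in simp)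
qed

lemma tanh_a: "tanh a = k / (2 * H)"
  unfolding half_length_def k_def[symmetric]
  using k_less k_pos H_pos by (intro tanh_artanh_real) simp

lemma a_pos: "a > 0"
  using tanh_a k_pos H_pos tanh_real_pos_iff[of a] by simp

definition num :: "real \<Rightarrow> real" where "num s = 1 + 4 * H\<^sup>2 / \<kappa> * (tanh s)\<^sup>2"
definition den :: "real \<Rightarrow> real" where "den s = 1 - 4 * \<tau>\<^sup>2 / \<kappa> * (tanh s)\<^sup>2"

lemma rho_eq: "\<rho> s = sqrt (num s) / sqrt (den s)"
  by (simp add: prof_rho_def num_def den_def)

lemma den_ge_1: "den s \<ge> 1"
  using \<kappa>_neg by (simp add: den_def divide_nonneg_neg mult_nonneg_nonneg mult_nonpos_nonneg divide_nonneg_neg)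

lemma tanh_square_mono:
  fixes s s' :: real
  assumes "0 \<le> s" "s < s'"
  shows "(tanh s)\<^sup>2 < (tanh s')\<^sup>2"
  using assms strict_monoD[OF tanh_real_strict_mono assms(2)]
  by (intro power_strict_mono) simp_all

text \<open>The half length is the parameter at which the profile curve reaches the equator: tanh a
  = k / (2H) makes 1 + (4H^2 / \<kappa>) tanh^2 a vanish.\<close>

lemma num_a: "num a = 0"
  using H_pos k_square \<kappa>_neg by (simp add: num_def tanh_a power_divide)

lemma num_strict_decreasing:
  assumes "0 \<le> s" "s < s'"
  shows "num s' < num s"
proof -
  have "4 * H\<^sup>2 / \<kappa> < 0" using \<kappa>_neg H_pos by (simp add: divide_pos_neg)
  then show ?thesis
    unfolding num_def using mult_strict_left_mono_neg[OF tanh_square_mono[OF assms]] add_strict_left_mono by blast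
qed

lemma den_mono:
  assumes "0 \<le> s" "s < s'"
  shows "den s \<le> den s'"
proof -
  have "4 * \<tau>\<^sup>2 / \<kappa> \<le> 0" using \<kappa>_neg by (simp add: divide_nonneg_neg)
  then show ?thesis
    unfolding den_def using mult_left_mono_neg[OF less_imp_le[OF tanh_square_mono[OF assms]]] diff_left_mono by blast
qed

lemma num_nonneg: "0 \<le> s \<Longrightarrow> s \<le> a \<Longrightarrow> num s \<ge> 0"
  using num_strict_decreasing[of s a] num_a by (cases "s = a") auto

lemma num_pos: "0 \<le> s \<Longrightarrow> s < a \<Longrightarrow> num s > 0"
  using num_strict_decreasing[of s a] num_a by auto

lemma rho_strict_decreasing:
  assumes "0 \<le> s" "s < s'" "s' \<le> a"
  shows "\<rho> s' < \<rho> s"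
proof -
  have "\<rho> s' \<le> sqrt (num s') / sqrt (den s)"
    unfolding rho_eq using den_mono[OF assms(1,2)] den_ge_1[of s] num_nonneg[of s'] assms
    by (intro divide_left_mono) auto
  also have "\<dots> < \<rho> s"
    unfolding rho_eq using num_strict_decreasing[OF assms(1,2)] den_ge_1[of s]
    by (intro divide_strict_right_mono) auto
  finally show ?thesis .
qed

lemma rho_0: "\<rho> 0 = 1" and rho_a: "\<rho> a = 0"
  by (simp_all add: rho_eq num_a, simp add: num_def den_def)

lemma rho_bounds:
  assumes "0 \<le> s" "s \<le> a"
  shows "0 \<le> \<rho> s" "\<rho> s \<le> 1"
  using rho_strict_decreasing[of s a] rho_strict_decreasing[of 0 s] assms rho_0 rho_a a_pos
  by (cases "s = a"; cases "s = 0"; force)+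

lemma rho_pos: "0 \<le> s \<Longrightarrow> s < a \<Longrightarrow> \<rho> s > 0"
  using rho_strict_decreasing[of s a] rho_a by simp

lemma rho_less_1: "0 < s \<Longrightarrow> s \<le> a \<Longrightarrow> \<rho> s < 1"
  using rho_strict_decreasing[of 0 s] rho_0 by simp

lemma continuous_on_rho: "continuous_on A \<rho>"
proof -
  have "den s \<noteq> 0" for s using den_ge_1[of s] by simp
  then show ?thesis
    unfolding rho_eq[abs_def] using \<kappa>_neg by (intro continuous_intros) (auto simp: num_def[abs_def] den_def[abs_def] intro!: continuous_intros)
qed

text \<open>Both ends are excluded: at 0 the slope is zero, since tanh 0 = 0, and at a it is
  infinite, since the root in the numerator reaches zero there.\<close>

lemma rho_derivative:
  assumes "0 < s" "s < a"
  obtains d where "d < 0" "(\<rho> has_real_derivative d) (at s)"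
proof -
  define u where "u = 2 * tanh s * (1 - (tanh s)\<^sup>2)"
  have "(tanh s)\<^sup>2 < 1"
    using tanh_real_bounds[of s] by (auto simp: abs_square_less_1 abs_less_iff)
  then have u: "u > 0" using assms by (simp add: u_def)
  have t: "((\<lambda>s. (tanh s)\<^sup>2) has_real_derivative u) (at s)"
    by (auto intro!: derivative_eq_intros simp: u_def power2_eq_square algebra_simps)
  have n: "(num has_real_derivative 4 * H\<^sup>2 / \<kappa> * u) (at s)"
    unfolding num_def[abs_def] using DERIV_add[OF DERIV_const DERIV_cmult[OF t]] unfolding add_0_left .
  have m: "(den has_real_derivative - (4 * \<tau>\<^sup>2 / \<kappa> * u)) (at s)"
    unfolding den_def[abs_def] using DERIV_diff[OF DERIV_const DERIV_cmult[OF t]] unfolding diff_0 .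
  have pos: "num s > 0" "den s > 0" using num_pos[of s] den_ge_1[of s] assms by simp_all
  have sn: "((\<lambda>s. sqrt (num s)) has_real_derivative inverse (sqrt (num s)) / 2 * (4 * H\<^sup>2 / \<kappa> * u)) (at s)"
    using DERIV_chain2[where f = sqrt and g = num, OF DERIV_real_sqrt[OF pos(1)] n] .
  have sm: "((\<lambda>s. sqrt (den s)) has_real_derivative inverse (sqrt (den s)) / 2 * - (4 * \<tau>\<^sup>2 / \<kappa> * u)) (at s)"
    using DERIV_chain2[where f = sqrt and g = den, OF DERIV_real_sqrt[OF pos(2)] m] .
  have n': "inverse (sqrt (num s)) / 2 * (4 * H\<^sup>2 / \<kappa> * u) < 0"
  proof (rule mult_pos_neg)
    show "4 * H\<^sup>2 / \<kappa> * u < 0"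
      by (rule mult_neg_pos[OF divide_pos_neg u]) (use \<kappa>_neg H_pos in simp_all)
  qed (use pos in simp)
  have m': "inverse (sqrt (den s)) / 2 * - (4 * \<tau>\<^sup>2 / \<kappa> * u) > 0"
    using pos u \<kappa>_neg \<tau>_nz by (intro mult_pos_pos) (simp_all add: mult_neg_pos divide_pos_neg)
  have nz: "sqrt (den s) \<noteq> 0" using pos by simp
  show ?thesis
  proof (rule that)
    show "(\<rho> has_real_derivative
        (inverse (sqrt (num s)) / 2 * (4 * H\<^sup>2 / \<kappa> * u) * sqrt (den s)
          - sqrt (num s) * (inverse (sqrt (den s)) / 2 * - (4 * \<tau>\<^sup>2 / \<kappa> * u))) / (sqrt (den s) * sqrt (den s))) (at s)"
      unfolding rho_eq[abs_def] by (rule DERIV_divide[OF sn sm nz])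
    show "(inverse (sqrt (num s)) / 2 * (4 * H\<^sup>2 / \<kappa> * u) * sqrt (den s)
          - sqrt (num s) * (inverse (sqrt (den s)) / 2 * - (4 * \<tau>\<^sup>2 / \<kappa> * u))) / (sqrt (den s) * sqrt (den s)) < 0"
    proof (rule divide_neg_pos)
      show "inverse (sqrt (num s)) / 2 * (4 * H\<^sup>2 / \<kappa> * u) * sqrt (den s)
          - sqrt (num s) * (inverse (sqrt (den s)) / 2 * - (4 * \<tau>\<^sup>2 / \<kappa> * u)) < 0"
        unfolding diff_less_0_iff_less
        by (rule less_trans[OF mult_neg_pos[OF n'] mult_pos_pos[OF _ m']]) (use pos in simp_all)
      show "sqrt (den s) * sqrt (den s) > 0" using pos by simp
    qed
  qed
qed

lemma tanh_square_height:
  assumes "0 \<le> s" "s \<le> a" "h\<^sup>2 = (\<rho> s)\<^sup>2"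
  shows "(tanh s)\<^sup>2 * (4 * H\<^sup>2 + 4 * \<tau>\<^sup>2 * h\<^sup>2) = k\<^sup>2 * (1 - h\<^sup>2)"
proof -
  have "h\<^sup>2 * den s = num s"
    unfolding assms(3) rho_eq using num_nonneg[OF assms(1,2)] den_ge_1[of s] by (simp add: power_divide)
  then have "\<kappa> * (h\<^sup>2 * den s) = \<kappa> * num s" by simp
  then have "h\<^sup>2 * (\<kappa> - 4 * \<tau>\<^sup>2 * (tanh s)\<^sup>2) = \<kappa> + 4 * H\<^sup>2 * (tanh s)\<^sup>2"
    unfolding den_def num_def using \<kappa>_neg by (simp add: algebra_simps)
  then show ?thesis unfolding k_square by (simp add: algebra_simps)
qed

text \<open>With Q = 4(H^2 + \<tau>^2 h^2) the relation for tanh s reads D = Q (1 - tanh^2 s), and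
  cosh^2 s = 1 / (1 - tanh^2 s).\<close>

lemma cosh_height:
  assumes "0 \<le> s" "s \<le> a" "h\<^sup>2 = (\<rho> s)\<^sup>2"
  shows "cosh s = 2 * sqrt (H\<^sup>2 + \<tau>\<^sup>2 * h\<^sup>2) / sqrt (D h)"
    and "sinh s = k * sqrt (1 - h\<^sup>2) / sqrt (D h)"
proof -
  define Q where "Q = 4 * H\<^sup>2 + 4 * \<tau>\<^sup>2 * h\<^sup>2"
  note t = tanh_square_height[OF assms, folded Q_def]
  have D: "D h = Q - k\<^sup>2 * (1 - h\<^sup>2)"
    unfolding D_def Q_def k_square by (simp add: algebra_simps)
  have c: "(cosh s)\<^sup>2 * (1 - (tanh s)\<^sup>2) = 1"
    by (simp add: right_diff_distrib tanh_def power_divide hyperbolic_pythagoras)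
  have "(cosh s)\<^sup>2 * D h = Q * ((cosh s)\<^sup>2 * (1 - (tanh s)\<^sup>2))"
    unfolding D t[symmetric] by (simp add: algebra_simps)
  then have c2: "(cosh s)\<^sup>2 = Q / D h"
    using D_pos[of h] by (simp add: c field_simps)
  have "cosh s = sqrt (Q / D h)" unfolding c2[symmetric] by simp
  also have "\<dots> = sqrt (4 * (H\<^sup>2 + \<tau>\<^sup>2 * h\<^sup>2)) / sqrt (D h)"
    by (simp add: real_sqrt_divide Q_def)
  also have "sqrt (4 * (H\<^sup>2 + \<tau>\<^sup>2 * h\<^sup>2)) = 2 * sqrt (H\<^sup>2 + \<tau>\<^sup>2 * h\<^sup>2)"
    by (simp only: real_sqrt_mult) simp
  finally show "cosh s = 2 * sqrt (H\<^sup>2 + \<tau>\<^sup>2 * h\<^sup>2) / sqrt (D h)" .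
  have "(sinh s)\<^sup>2 = (Q - D h) / D h"
    using c2 D_pos[of h] by (simp add: cosh_square_eq field_simps)
  then have s2: "(sinh s)\<^sup>2 = k\<^sup>2 * (1 - h\<^sup>2) / D h" unfolding D by simp
  have "sinh s = sqrt (k\<^sup>2 * (1 - h\<^sup>2) / D h)" unfolding s2[symmetric] using assms(1) by simp
  also have "\<dots> = k * sqrt (1 - h\<^sup>2) / sqrt (D h)"
    using k_pos by (simp only: real_sqrt_divide real_sqrt_mult) simp
  finally show "sinh s = k * sqrt (1 - h\<^sup>2) / sqrt (D h)" .
qed

section \<open>The angle along the profile curve\<close>

definition profile :: "real \<Rightarrow> real" where
  "profile h = arctan (\<tau> / H * h) - angle h"

lemma prof_y_eq: "y s = profile (\<rho> s)"
  by (simp add: prof_y_def profile_def angle_def)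

lemma profile_minus: "profile (- h) = - profile h"
  by (simp add: profile_def angle_def arctan_minus)

text \<open>The number H - i \<tau> h has argument -arctan(\<tau> h / H), because H is positive;
  together with \<omega> this is the negative of \<open>profile\<close>.\<close>

lemma meridian_polar:
  "meridian h = of_real (2 * sqrt (H\<^sup>2 + \<tau>\<^sup>2 * h\<^sup>2) / sqrt (D h)) * cis (- profile h)"
proof -
  define u where "u = \<tau> / H * h"
  have pos: "1 + u\<^sup>2 > 0" by (simp add: add_pos_nonneg)
  have Q: "H\<^sup>2 + \<tau>\<^sup>2 * h\<^sup>2 = H\<^sup>2 * (1 + u\<^sup>2)"
    using H_pos by (simp add: u_def power_mult_distrib power_divide field_simps)
  have "sqrt (H\<^sup>2 + \<tau>\<^sup>2 * h\<^sup>2) = H * sqrt (1 + u\<^sup>2)"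
    unfolding Q using H_pos by (simp add: real_sqrt_mult)
  then have "of_real (sqrt (H\<^sup>2 + \<tau>\<^sup>2 * h\<^sup>2)) * cis (- arctan u) = Complex H (- \<tau> * h)"
    using pos H_pos by (simp add: complex_eq_iff cos_arctan sin_arctan) (simp add: u_def)
  then have "meridian h = (2 / sqrt (D h)) *\<^sub>R (of_real (sqrt (H\<^sup>2 + \<tau>\<^sup>2 * h\<^sup>2)) * (cis (- arctan u) * cis (angle h)))"
    unfolding meridian_def by (simp add: mult.assoc)
  also have "cis (- arctan u) * cis (angle h) = cis (- profile h)"
    by (simp add: cis_mult profile_def u_def)
  finally show ?thesis by (simp add: scaleR_conv_of_real)
qed

text \<open>The factor \<tau> treats both signs at once. The derivative of \<tau>
  \<open>profile\<close> is -H k^2 S / (Q D), with Q = H^2 + \<tau>^2 h^2, negative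
  everywhere.\<close>

lemma profile_decreasing:
  assumes "h < h'"
  shows "\<tau> * profile h' < \<tau> * profile h"
proof (rule DERIV_neg_imp_decreasing[OF assms])
  fix x
  define Q where "Q = H\<^sup>2 + \<tau>\<^sup>2 * x\<^sup>2"
  define C where "C = 4 * \<tau>\<^sup>2 - \<kappa>"
  have Q: "Q > 0" using H_pos by (simp add: Q_def add_pos_nonneg)
  define c where "c = \<tau> / H"
  have "((\<lambda>h. arctan (c * h)) has_real_derivative inverse (1 + (c * x)\<^sup>2) * c) (at x)"
    by (auto intro!: derivative_eq_intros)
  also have "inverse (1 + (c * x)\<^sup>2) * c = H * \<tau> / Q"
  proof -
    have "1 + (c * x)\<^sup>2 = Q / H\<^sup>2"
      using H_pos by (simp add: c_def Q_def power_mult_distrib power_divide add_divide_distrib)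
    then show ?thesis using H_pos by (simp add: c_def power2_eq_square)
  qed
  finally have "((\<lambda>h. \<tau> * profile h) has_real_derivative \<tau> * (H * \<tau> / Q - H * C / (\<tau> * D x))) (at x)"
    unfolding profile_def c_def C_def by (intro DERIV_cmult DERIV_diff angle_derivative)
  moreover have "\<tau> * (H * \<tau> / Q - H * C / (\<tau> * D x)) = - H * (C * Q - \<tau>\<^sup>2 * D x) / (Q * D x)"
    using Q D_pos[of x] \<tau>_nz by (simp add: divide_simps) (simp add: algebra_simps power2_eq_square)
  moreover have "C * Q - \<tau>\<^sup>2 * D x = k\<^sup>2 * S"
    unfolding C_def Q_def D_def S_def k_square by (simp add: algebra_simps)
  moreover have "- H * (k\<^sup>2 * S) / (Q * D x) < 0"
    using H_pos k_pos S_pos Q D_pos[of x] by (intro divide_neg_pos) simp_all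
  ultimately show "\<exists>d. ((\<lambda>h. \<tau> * profile h) has_real_derivative d) (at x) \<and> d < 0" by metis
qed

lemma prof_y_a: "y a = 0"
  by (simp add: prof_y_eq rho_a profile_def angle_def)

lemma prof_y_neg:
  assumes "0 \<le> s" "s < a"
  shows "\<tau> * y s < 0"
  using profile_decreasing[OF rho_pos[OF assms]] by (simp add: prof_y_eq profile_def angle_def)

lemma prof_y_abs_le:
  assumes "0 \<le> s" "s \<le> a"
  shows "\<bar>y s\<bar> \<le> \<bar>y 0\<bar>"
proof (cases "s = a")
  case True
  then show ?thesis by (simp add: prof_y_a)
next
  case False
  then have "\<tau> * y s < 0" using prof_y_neg assms by simp
  moreover have "\<tau> * y 0 \<le> \<tau> * y s"
    using profile_decreasing[of "\<rho> s" "\<rho> 0"] rho_strict_decreasing[of 0 s] assms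
    by (cases "s = 0") (auto simp: prof_y_eq)
  ultimately have "\<bar>\<tau> * y s\<bar> \<le> \<bar>\<tau> * y 0\<bar>" by linarith
  then show ?thesis using \<tau>_nz by (simp add: abs_mult)
qed

lemma continuous_on_prof_y: "continuous_on A y"
  unfolding prof_y_eq[abs_def] profile_def angle_def
  by (intro continuous_intros continuous_on_rho)

end

section \<open>The spherical parametrization\<close>

lemma spherical_nth:
  "spherical \<sigma> (x, t) $ 1 = sqrt (1 - (\<sigma> x)\<^sup>2) * cos t"
  "spherical \<sigma> (x, t) $ 2 = sqrt (1 - (\<sigma> x)\<^sup>2) * sin t"
  "spherical \<sigma> (x, t) $ 3 = \<sigma> x"
  by (simp_all add: spherical_def)

context rotational_sphere begin

definition height :: "real \<Rightarrow> real" where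
  "height x = (if x < 0 then - \<rho> (x + a) else \<rho> (a - x))"

lemma height_square: "(height x)\<^sup>2 = (\<rho> (a - \<bar>x\<bar>))\<^sup>2"
  by (simp add: height_def add.commute)

text \<open>The two branches of \<open>Phi\<close> merge into one formula with \<open>sgn\<close>.
  At x = 0, where \<open>sgn\<close> is 0, it is correct because y vanishes at a.\<close>

lemma Phi_eq:
  assumes "\<bar>x\<bar> \<le> a"
  shows "Phi \<kappa> \<tau> H (x, t) =
     (of_real (cosh (a - \<bar>x\<bar>)) * cis (- sgn x * y (a - \<bar>x\<bar>)), of_real (sinh (a - \<bar>x\<bar>)) * cis t)"
proof (cases x "0 :: real" rule: linorder_cases)
  case equal
  then show ?thesis by (simp add: Phi_def Let_def cis_conv_exp prof_y_a)
qed (simp_all add: Phi_def Let_def cis_conv_exp add.commute)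

text \<open>Moduli agree by \<open>cosh_height\<close> and phases by \<open>meridian_polar\<close>;
  \<open>profile\<close> is odd, which accounts for the opposite signs of the angle on the two
  hemispheres.\<close>

lemma immersion_spherical:
  assumes "\<bar>x\<bar> \<le> a"
  shows "immersion (spherical height (x, t)) = Phi \<kappa> \<tau> H (x, t)"
proof -
  have s: "0 \<le> a - \<bar>x\<bar>" "a - \<bar>x\<bar> \<le> a" using assms by simp_all
  note c = cosh_height[OF s height_square]
  have p: "- profile (height x) = - sgn x * y (a - \<bar>x\<bar>)"
    by (cases x "0 :: real" rule: linorder_cases)
      (simp_all add: height_def prof_y_eq profile_minus add.commute rho_a, simp add: profile_def angle_def)
  have "fst (immersion (spherical height (x, t))) = of_real (cosh (a - \<bar>x\<bar>)) * cis (- sgn x * y (a - \<bar>x\<bar>))"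
    by (simp only: immersion_def spherical_nth meridian_polar c(1) p fst_conv)
  moreover have "horizontal (spherical height (x, t)) = of_real (sqrt (1 - (height x)\<^sup>2)) * cis t"
    by (simp add: horizontal_def spherical_nth complex_eq_iff)
  then have "snd (immersion (spherical height (x, t))) = of_real (sinh (a - \<bar>x\<bar>)) * cis t"
    by (simp add: immersion_def spherical_nth c(2) scaleR_conv_of_real)
  ultimately show ?thesis unfolding Phi_eq[OF assms] by (simp add: prod_eq_iff)
qed

lemma height_strict_mono: "strict_mono_on {-a<..<a} height"
proof (rule strict_mono_onI)
  fix x x' assume x: "x \<in> {-a<..<a}" "x' \<in> {-a<..<a}" "x < x'"
  consider "x' < 0" | "x < 0" "x' \<ge> 0" | "x \<ge> 0" using x by linarith
  then show "height x < height x'"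
  proof cases
    case 1
    then show ?thesis using x rho_strict_decreasing[of "x + a" "x' + a"] by (simp add: height_def)
  next
    case 2
    then show ?thesis using x rho_pos[of "x + a"] rho_bounds(1)[of "a - x'"] by (simp add: height_def)
  next
    case 3
    then show ?thesis using x rho_strict_decreasing[of "a - x'" "a - x"] by (simp add: height_def)
  qed
qed

lemma rho_surj:
  assumes "0 \<le> h" "h < 1"
  obtains s where "0 < s" "s \<le> a" "\<rho> s = h"
proof -
  obtain s where s: "0 \<le> s" "s \<le> a" "\<rho> s = h"
    using IVT2'[of \<rho> a h 0] rho_0 rho_a assms a_pos continuous_on_rho by auto
  moreover have "s \<noteq> 0" using s(3) rho_0 assms(2) by auto
  ultimately show ?thesis using that[of s] by simp
qed

lemma height_image: "height ` {-a<..<a} = {-1<..<1}"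
proof (intro equalityI subsetI)
  fix h assume "h \<in> height ` {-a<..<a}"
  then obtain x where "x \<in> {-a<..<a}" and hx: "h = height x" by blast
  then have x: "\<bar>x\<bar> < a" by auto
  have "0 \<le> \<rho> (a - \<bar>x\<bar>)" "\<rho> (a - \<bar>x\<bar>) < 1"
    using x rho_bounds(1)[of "a - \<bar>x\<bar>"] rho_less_1[of "a - \<bar>x\<bar>"] by simp_all
  then show "h \<in> {-1<..<1}" unfolding hx height_def by (auto simp: add.commute)
next
  fix h :: real assume h: "h \<in> {-1<..<1}"
  show "h \<in> height ` {-a<..<a}"
  proof (cases "h \<ge> 0")
    case True
    then obtain s where s: "0 < s" "s \<le> a" "\<rho> s = h" using h rho_surj[of h] by auto
    then have "height (a - s) = h" "a - s \<in> {-a<..<a}" using a_pos by (auto simp: height_def)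
    then show ?thesis by blast
  next
    case False
    then obtain s where s: "0 < s" "s \<le> a" "\<rho> s = - h" using h rho_surj[of "- h"] by auto
    then have "s \<noteq> a" using False rho_a by auto
    then have "height (s - a) = h" "s - a \<in> {-a<..<a}" using s a_pos by (auto simp: height_def)
    then show ?thesis by blast
  qed
qed

lemma height_derivative:
  assumes "x \<in> {-a<..<a} - {0}"
  shows "\<exists>d>0. (height has_real_derivative d) (at x)"
proof (cases "x < 0")
  case True
  then obtain d where d: "d < 0" "(\<rho> has_real_derivative d) (at (x + a))"
    using assms rho_derivative[of "x + a"] by auto
  have "((\<lambda>x. - \<rho> (x + a)) has_real_derivative - d) (at x)"
    using DERIV_minus[OF DERIV_shift[THEN iffD1, OF d(2)]] .
  then have "(height has_real_derivative - d) (at x)"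
    by (rule has_field_derivative_transform_within_open[of _ _ _ "{..<0}"]) (use True in \<open>auto simp: height_def\<close>)
  then show ?thesis using d(1) by (intro exI[of _ "- d"]) simp
next
  case False
  then have x: "x > 0" using assms by auto
  then obtain d where d: "d < 0" "(\<rho> has_real_derivative d) (at (a - x))"
    using assms rho_derivative[of "a - x"] by auto
  have "((\<lambda>x. \<rho> (a - x)) has_real_derivative d * - 1) (at x)"
    by (rule DERIV_chain2[where f = \<rho> and g = "\<lambda>x. a - x", OF d(2)]) (auto intro!: derivative_eq_intros)
  then have "((\<lambda>x. \<rho> (a - x)) has_real_derivative - d) (at x)" by simp
  then have "(height has_real_derivative - d) (at x)"
    by (rule has_field_derivative_transform_within_open[of _ _ _ "{0<..}"]) (use x in \<open>auto simp: height_def\<close>)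
  then show ?thesis using d(1) by (intro exI[of _ "- d"]) simp
qed

lemma immersion_defines_sphere: "defines_sphere a (Phi \<kappa> \<tau> H) immersion"
  unfolding defines_sphere_def
proof (intro conjI exI[of _ height] immersion_sphere_immersion height_strict_mono height_image ballI height_derivative)
  fix q assume "q \<in> {-a<..<a} \<times> {-pi<..<pi}"
  then show "immersion (spherical height q) = Phi \<kappa> \<tau> H q"
    by (cases q) (auto intro!: immersion_spherical)
qed assumption

end

section \<open>End limits of a monotone height function\<close>

lemma tendsto_strict_mono_on_right:
  fixes \<sigma> :: "real \<Rightarrow> real"
  assumes "strict_mono_on {b<..<c} \<sigma>" "\<sigma> ` {b<..<c} = {l<..<u}" "b < c"
  shows "(\<sigma> \<longlongrightarrow> u) (at_left c)"
proof (rule order_tendstoI)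
  fix z assume "z < u"
  have "l < u" using assms(2,3) by (metis greaterThanLessThan_empty_iff image_is_empty not_le)
  \<comment> \<open>The midpoint guarantees a value inside the image even when z lies below
    l.\<close>
  then have "max z ((l + u) / 2) \<in> \<sigma> ` {b<..<c}" unfolding assms(2) using \<open>z < u\<close> by (auto simp: max_def)
  then obtain x where x: "x \<in> {b<..<c}" "\<sigma> x \<ge> z" by (metis imageE max.cobounded1)
  have "\<sigma> x' > z" if "x < x'" "x' < c" for x'
    using strict_mono_onD[OF assms(1) x(1), of x'] x that by auto
  then show "\<forall>\<^sub>F x in at_left c. z < \<sigma> x"
    unfolding eventually_at_left_field using x(1) by auto
next
  fix z assume "z > u"
  have "\<sigma> x < z" if "b < x" "x < c" for x
  proof -
    have "\<sigma> x \<in> {l<..<u}" using that assms(2) by auto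
    then show ?thesis using \<open>z > u\<close> by simp
  qed
  then show "\<forall>\<^sub>F x in at_left c. \<sigma> x < z"
    unfolding eventually_at_left_field using assms(3) by auto
qed

lemma tendsto_strict_mono_on_left:
  fixes \<sigma> :: "real \<Rightarrow> real"
  assumes "strict_mono_on {b<..<c} \<sigma>" "\<sigma> ` {b<..<c} = {l<..<u}" "b < c"
  shows "(\<sigma> \<longlongrightarrow> l) (at_right b)"
proof -
  have r: "uminus ` {-c<..<-b} = {b<..<c}" by simp
  have "strict_mono_on {-c<..<-b} (\<lambda>x. - \<sigma> (- x))"
    using assms(1) by (auto simp: strict_mono_on_def)
  moreover have "(\<lambda>x. - \<sigma> (- x)) ` {-c<..<-b} = {-u<..<-l}"
  proof -
    have "(\<lambda>x. - \<sigma> (- x)) ` {-c<..<-b} = uminus ` (\<sigma> ` (uminus ` {-c<..<-b}))" by (simp only: image_image)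
    then show ?thesis unfolding r assms(2) by simp
  qed
  ultimately have "((\<lambda>x. - \<sigma> (- x)) \<longlongrightarrow> - l) (at_left (- b))"
    by (rule tendsto_strict_mono_on_right) (use assms(3) in simp)
  from tendsto_minus[OF this] show ?thesis
    by (simp add: filterlim_at_left_to_right)
qed

section \<open>Embeddedness\<close>

lemma spherical_in_S2:
  assumes "\<bar>\<sigma> x\<bar> \<le> 1"
  shows "spherical \<sigma> (x, t) \<in> S2"
proof -
  have "(\<sigma> x)\<^sup>2 \<le> 1" using assms by (simp add: abs_square_le_1)
  then have "(spherical \<sigma> (x, t) $ 1)\<^sup>2 + (spherical \<sigma> (x, t) $ 2)\<^sup>2 + (spherical \<sigma> (x, t) $ 3)\<^sup>2
      = (1 - (\<sigma> x)\<^sup>2) * ((sin t)\<^sup>2 + (cos t)\<^sup>2) + (\<sigma> x)\<^sup>2"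
    by (simp only: spherical_nth power_mult_distrib real_sqrt_pow2 diff_ge_0_iff_ge) (simp only: algebra_simps)
  then show ?thesis by (simp add: norm_vec_def L2_set_def sum_3)
qed

lemma continuous_on_vector3:
  fixes f g h :: "'a::topological_space \<Rightarrow> real"
  assumes "continuous_on A f" "continuous_on A g" "continuous_on A h"
  shows "continuous_on A (\<lambda>x. vector [f x, g x, h x] :: real ^ 3)"
proof -
  have "vector [u, v, w] = u *\<^sub>R axis 1 1 + v *\<^sub>R axis 2 1 + w *\<^sub>R (axis 3 1 :: real ^ 3)" for u v w
    by (simp add: vec_eq_iff forall_3 axis_def)
  then show ?thesis using assms by (simp add: continuous_intros)
qed

lemma limits_eq_if_eventually_eq:
  fixes f g :: "real \<Rightarrow> 'b::t2_space"
  assumes "(f \<longlongrightarrow> l) F" "(g \<longlongrightarrow> m) F" "F \<noteq> bot" "\<forall>\<^sub>F x in F. f x = g x"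
  shows "l = m"
  using tendsto_unique[OF assms(3) _ assms(2)] tendsto_cong[OF assms(4)] assms(1) by blast

context rotational_sphere begin

text \<open>The formula of \<open>Phi_eq\<close> taken on the whole plane, so that it can also be
  evaluated on the missing meridian t = \<pi> and at the poles x = a and x = -a.\<close>

definition Psi :: "real \<times> real \<Rightarrow> c2" where
  "Psi = (\<lambda>(x, t). (of_real (cosh (a - \<bar>x\<bar>)) * cis (- sgn x * y (a - \<bar>x\<bar>)), of_real (sinh (a - \<bar>x\<bar>)) * cis t))"

text \<open>Applied at the poles, away from the jump of \<open>sgn\<close>.\<close>

lemma Psi_meridian_tendsto:
  assumes "x \<noteq> 0"
  shows "((\<lambda>x. Psi (x, t)) \<longlongrightarrow> Psi (x, t)) (at x within A)"
proof -
  have "continuous (at z) y" for z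
    using continuous_on_prof_y[of UNIV] by (simp add: continuous_on_eq_continuous_at)
  then have "((\<lambda>x. y (a - \<bar>x\<bar>)) \<longlongrightarrow> y (a - \<bar>x\<bar>)) (at x within A)"
    by (intro isCont_tendsto_compose[where g = y] tendsto_intros) auto
  then show ?thesis
    unfolding Psi_def prod.case by (intro tendsto_intros assms)
qed

text \<open>F is known only on the open rectangle and its height function is arbitrary. Continuity
  of F on the sphere determines it on the meridian t = \<pi> and at both poles, so questions about F
  become questions about \<open>Psi\<close>.\<close>

lemma sphere_map_eq_Psi:
  assumes "defines_sphere a (Phi \<kappa> \<tau> H) F"
  obtains \<sigma> where "strict_mono_on {-a..a} \<sigma>" "\<sigma> a = 1" "\<sigma> (-a) = -1"
    "\<And>h. \<bar>h\<bar> \<le> 1 \<Longrightarrow> \<exists>x\<in>{-a..a}. \<sigma> x = h"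
    "\<And>x t. \<lbrakk>x \<in> {-a..a}; -pi < t; t \<le> pi\<rbrakk> \<Longrightarrow> F (spherical \<sigma> (x, t)) = Psi (x, t)"
proof -
  obtain \<sigma>\<^sub>0 where s0: "strict_mono_on {-a<..<a} \<sigma>\<^sub>0" "\<sigma>\<^sub>0 ` {-a<..<a} = {-1<..<1}"
    and F: "\<And>q. q \<in> {-a<..<a} \<times> {-pi<..<pi} \<Longrightarrow> F (spherical \<sigma>\<^sub>0 q) = Phi \<kappa> \<tau> H q"
    using assms unfolding defines_sphere_def by blast
  have cF: "continuous_on S2 F"
    using assms smooth_S2_continuous_on by (auto simp: defines_sphere_def sphere_immersion_def)
  define \<sigma> where "\<sigma> x = (if x = a then 1 else if x = - a then - 1 else \<sigma>\<^sub>0 x)" for x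
  have aa: "a \<noteq> - a" using a_pos by simp
  have in0: "\<sigma>\<^sub>0 x \<in> {-1<..<1}" if "x \<in> {-a<..<a}" for x using that s0(2) by blast
  have s_eq: "\<sigma> x = \<sigma>\<^sub>0 x" if "x \<in> {-a<..<a}" for x using that by (auto simp: \<sigma>_def)
  have sa: "\<sigma> a = 1" "\<sigma> (-a) = -1" using aa by (simp_all add: \<sigma>_def)
  have mono: "strict_mono_on {-a..a} \<sigma>"
  proof (rule strict_mono_onI)
    fix x x' assume x: "x \<in> {-a..a}" "x' \<in> {-a..a}" "x < x'"
    consider "x = -a" "x' = a" | "x = -a" "x' \<in> {-a<..<a}" | "x \<in> {-a<..<a}" "x' = a"
      | "x \<in> {-a<..<a}" "x' \<in> {-a<..<a}" using x by fastforce
    then show "\<sigma> x < \<sigma> x'"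
    proof cases
      case 4
      then show ?thesis using s0(1) x(3) by (simp add: s_eq strict_mono_on_def)
    qed (use in0 in \<open>auto simp: sa s_eq\<close>)
  qed
  have surj: "\<exists>x\<in>{-a..a}. \<sigma> x = h" if "\<bar>h\<bar> \<le> 1" for h
  proof (cases "\<bar>h\<bar> = 1")
    case True
    then have "h = 1 \<or> h = -1" by auto
    moreover have "a \<in> {-a..a}" "-a \<in> {-a..a}" using a_pos by simp_all
    ultimately show ?thesis using sa by metis
  next
    case False
    then have "h \<in> \<sigma>\<^sub>0 ` {-a<..<a}" unfolding s0(2) using that by auto
    then obtain x where "x \<in> {-a<..<a}" "h = \<sigma>\<^sub>0 x" by blast
    then show ?thesis using s_eq by (intro bexI[of _ x]) auto
  qed
  have bd: "\<bar>\<sigma> x\<bar> \<le> 1" if "x \<in> {-a..a}" for x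
  proof (cases "x \<in> {-a<..<a}")
    case True
    then show ?thesis using in0 s_eq by force
  next
    case False
    then have "x = a \<or> x = - a" using that by auto
    then show ?thesis using sa by auto
  qed
  have open_eq: "F (spherical \<sigma> (x, t)) = Psi (x, t)" if "x \<in> {-a<..<a}" "t \<in> {-pi<..<pi}" for x t
  proof -
    have "spherical \<sigma> (x, t) = spherical \<sigma>\<^sub>0 (x, t)" using s_eq[OF that(1)] by (simp add: spherical_def)
    moreover have "\<bar>x\<bar> \<le> a" using that(1) by auto
    ultimately show ?thesis using F[of "(x, t)"] that Phi_eq[of x t] by (simp add: Psi_def)
  qed
  \<comment> \<open>The missing meridian is approached by letting t tend to \<pi> from below at
    fixed height.\<close>
  have inner_eq: "F (spherical \<sigma> (x, t)) = Psi (x, t)" if x: "x \<in> {-a<..<a}" and t: "-pi < t" "t \<le> pi" for x t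
  proof (cases "t = pi")
    case False
    then show ?thesis using open_eq x t by simp
  next
    case True
    have "\<bar>\<sigma> x\<bar> \<le> 1" using bd x by simp
    then have S: "spherical \<sigma> (x, t) \<in> S2" for t by (rule spherical_in_S2)
    have "continuous_on UNIV (\<lambda>t. spherical \<sigma> (x, t))"
      unfolding spherical_def prod.case by (intro continuous_on_vector3 continuous_intros)
    then have "continuous_on UNIV (\<lambda>t. F (spherical \<sigma> (x, t)))"
      by (rule continuous_on_compose2[OF cF]) (use S in auto)
    then have "((\<lambda>t. F (spherical \<sigma> (x, t))) \<longlongrightarrow> F (spherical \<sigma> (x, pi))) (at_left pi)"
      by (simp add: continuous_on_def filterlim_at_split)
    moreover have "((\<lambda>t. Psi (x, t)) \<longlongrightarrow> Psi (x, pi)) (at_left pi)"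
      unfolding Psi_def prod.case by (intro tendsto_intros)
    moreover have "\<forall>\<^sub>F t in at_left pi. F (spherical \<sigma> (x, t)) = Psi (x, t)"
      using open_eq[OF x] unfolding eventually_at_left_field by (intro exI[of _ 0]) auto
    ultimately show ?thesis unfolding True
      by (intro limits_eq_if_eventually_eq[of _ _ "at_left pi"]) auto
  qed
  \<comment> \<open>The meridian t = 0 parametrized by height. It leads to the poles and does not
    involve the unknown height function, so F along it is continuous up to the ends.\<close>
  define m :: "real \<Rightarrow> real ^ 3" where "m u = vector [sqrt (1 - u\<^sup>2), 0, u]" for u
  have m_spherical: "spherical \<sigma> (x, 0) = m (\<sigma> x)" for x by (simp add: spherical_def m_def)
  have mS: "m u \<in> S2" if "\<bar>u\<bar> \<le> 1" for u
    using spherical_in_S2[of "\<lambda>x. x" u 0] that by (simp add: spherical_def m_def)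
  have cm: "continuous_on {-1..1} (\<lambda>u. F (m u))"
  proof (rule continuous_on_compose2[OF cF])
    show "continuous_on {-1..1} m"
      unfolding m_def by (intro continuous_on_vector3 continuous_intros)
    show "m ` {-1..1} \<subseteq> S2" using mS by auto
  qed
  have pole: "F (m (\<sigma> x)) = Psi (x, 0)" if "x \<noteq> 0" "\<bar>x\<bar> = a" "(\<sigma> \<longlongrightarrow> \<sigma> x) G" "G \<noteq> bot" "G = at x within {-a<..<a}"
      and ev: "\<forall>\<^sub>F x in G. x \<in> {-a<..<a}" for x G
  proof (rule limits_eq_if_eventually_eq[OF _ _ that(4)])
    have x: "x \<in> {-a..a}" using that(2) by auto
    show "((\<lambda>x. F (m (\<sigma> x))) \<longlongrightarrow> F (m (\<sigma> x))) G"
    proof (rule continuous_on_tendsto_compose[OF cm that(3)])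
      show "\<sigma> x \<in> {-1..1}" using bd[OF x] by auto
      show "\<forall>\<^sub>F x in G. \<sigma> x \<in> {-1..1}"
        using ev by (rule eventually_mono) (use in0 s_eq in force)
    qed
    show "((\<lambda>x. Psi (x, 0)) \<longlongrightarrow> Psi (x, 0)) G"
      unfolding that(5) by (rule Psi_meridian_tendsto[OF that(1)])
    show "\<forall>\<^sub>F x in G. F (m (\<sigma> x)) = Psi (x, 0)"
      using ev by (rule eventually_mono) (simp add: open_eq flip: m_spherical)
  qed
  have s_mono: "strict_mono_on {-a<..<a} \<sigma>" using mono by (auto simp: strict_mono_on_def)
  have s_im: "\<sigma> ` {-a<..<a} = {-1<..<1}" using s0(2) s_eq by simp
  have ends: "at a within {-a<..<a} = at_left a" "at (-a) within {-a<..<a} = at_right (-a)"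
    using a_pos at_within_nhd[of a "{0<..}" "{-a<..<a}" "{..<a}"]
      at_within_nhd[of "-a" "{..<0}" "{-a<..<a}" "{-a<..}"] by fastforce+
  have ev: "\<forall>\<^sub>F x in at z within A. x \<in> A" for z :: real and A
    by (simp add: eventually_at_filter)
  have poles: "F (m 1) = Psi (a, 0)" "F (m (-1)) = Psi (-a, 0)"
  proof -
    have "F (m (\<sigma> a)) = Psi (a, 0)"
      using a_pos tendsto_strict_mono_on_right[OF s_mono s_im]
      by (intro pole[OF _ _ _ _ refl ev]) (auto simp: sa ends)
    moreover have "F (m (\<sigma> (-a))) = Psi (-a, 0)"
      using a_pos tendsto_strict_mono_on_left[OF s_mono s_im]
      by (intro pole[OF _ _ _ _ refl ev]) (auto simp: sa ends)
    ultimately show "F (m 1) = Psi (a, 0)" "F (m (-1)) = Psi (-a, 0)" by (simp_all add: sa)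
  qed
  \<comment> \<open>At a pole the longitude is lost on both sides: the radius of the parallel is 0,
    and so is sinh (a - |x|).\<close>
  have pole_t: "spherical \<sigma> (x, t) = m (\<sigma> x)" "Psi (x, t) = Psi (x, 0)" if "\<bar>x\<bar> = a" for x t
  proof -
    have "x = a \<or> x = - a" using that by auto
    then have "(\<sigma> x)\<^sup>2 = 1" using sa by auto
    then show "spherical \<sigma> (x, t) = m (\<sigma> x)" "Psi (x, t) = Psi (x, 0)"
      using that by (simp_all add: spherical_def m_def Psi_def)
  qed
  have all_eq: "F (spherical \<sigma> (x, t)) = Psi (x, t)" if x: "x \<in> {-a..a}" and t: "-pi < t" "t \<le> pi" for x t
  proof (cases "\<bar>x\<bar> = a")
    case False
    then have "x \<in> {-a<..<a}" using x by auto
    then show ?thesis using inner_eq t by blast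
  next
    case True
    then have "x = a \<or> x = -a" by auto
    then have "F (m (\<sigma> x)) = Psi (x, 0)" using poles sa by auto
    then show ?thesis unfolding pole_t(1)[OF True] pole_t(2)[OF True, of t] .
  qed
  show ?thesis by (rule that[OF mono sa surj all_eq])
qed

text \<open>A continuous injection of the compact sphere into a Hausdorff space is a homeomorphism
  onto its image.\<close>

lemma embedding_iff_inj:
  assumes "sphere_immersion F"
  shows "sphere_embedding F \<longleftrightarrow> inj_on F S2"
proof
  assume "sphere_embedding F"
  then show "inj_on F S2"
    unfolding sphere_embedding_def embedding_map_def
    using homeomorphic_imp_injective_map by fastforce
next
  assume inj: "inj_on F S2"
  have "continuous_on S2 F" "F ` S2 \<subseteq> sl2r"
    using assms smooth_S2_continuous_on by (auto simp: sphere_immersion_def)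
  then have "embedding_map (top_of_set S2) (top_of_set sl2r) F"
    using inj by (intro continuous_imp_embedding_map) (auto simp: compact_space_subtopology Hausdorff_space_subtopology)
  then show "sphere_embedding F" using assms by (simp add: sphere_embedding_def)
qed

lemma embedding_iff:
  assumes F: "defines_sphere a (Phi \<kappa> \<tau> H) F"
  shows "sphere_embedding F \<longleftrightarrow> \<bar>y 0\<bar> < pi"
proof -
  obtain \<sigma> where s: "strict_mono_on {-a..a} \<sigma>" "\<sigma> a = 1" "\<sigma> (-a) = -1"
    and surj: "\<And>h. \<bar>h\<bar> \<le> 1 \<Longrightarrow> \<exists>x\<in>{-a..a}. \<sigma> x = h"
    and eq: "\<And>x t. \<lbrakk>x \<in> {-a..a}; -pi < t; t \<le> pi\<rbrakk> \<Longrightarrow> F (spherical \<sigma> (x, t)) = Psi (x, t)"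
    using sphere_map_eq_Psi[OF F] by metis
  have imm: "sphere_immersion F" using F by (simp add: defines_sphere_def)
  have bd: "\<bar>\<sigma> x\<bar> \<le> 1" if "x \<in> {-a..a}" for x
  proof -
    have "\<sigma> (-a) \<le> \<sigma> x" "\<sigma> x \<le> \<sigma> a"
      using strict_mono_on_leD[OF s(1)] that a_pos by auto
    then show ?thesis using s by simp
  qed
  have param: "\<exists>x t. x \<in> {-a..a} \<and> -pi < t \<and> t \<le> pi \<and> p = spherical \<sigma> (x, t)" if p: "p \<in> S2" for p
  proof -
    obtain r \<theta> where r: "r\<^sup>2 + (p $ 3)\<^sup>2 = 1" "r \<ge> 0" "p $ 1 = r * cos \<theta>" "p $ 2 = r * sin \<theta>"
      using sphere_coordinates[OF p] by metis
    have "(p $ 3)\<^sup>2 \<le> 1" using r(1) zero_le_power2[of r] by linarith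
    then obtain x where x: "x \<in> {-a..a}" "\<sigma> x = p $ 3" using surj[of "p $ 3"] by (auto simp: abs_square_le_1)
    have rr: "r = sqrt (1 - (\<sigma> x)\<^sup>2)" using r(1,2) unfolding x(2) by (intro real_sqrt_unique[symmetric]) auto
    \<comment> \<open>Reduces the longitude to the half-open interval on which F is known to equal
      \<open>Psi\<close>.\<close>
    define t where "t = Arg (cis \<theta>)"
    have t: "-pi < t" "t \<le> pi" "cis t = cis \<theta>"
      using Arg_bounded[of "cis \<theta>"] cis_Arg[of "cis \<theta>"] by (simp_all add: t_def)
    then have "cos t = cos \<theta>" "sin t = sin \<theta>" by (simp_all add: complex_eq_iff)
    then have "p = spherical \<sigma> (x, t)"
      using r(3,4) x(2) by (simp add: vec_eq_iff forall_3 spherical_nth rr)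
    then show ?thesis using x(1) t by blast
  qed
  have "inj_on F S2 \<longleftrightarrow> \<bar>y 0\<bar> < pi"
  proof
    assume inj: "inj_on F S2"
    show "\<bar>y 0\<bar> < pi"
    proof (rule ccontr)
      assume "\<not> \<bar>y 0\<bar> < pi"
      \<comment> \<open>On [0, a] the function |y| runs from a value at least \<pi> down to 0. Where
        it equals \<pi>, the points at x and -x with the same longitude have the same image; b = 0
        is the case of coinciding poles.\<close>
      then obtain b where b: "0 \<le> b" "b \<le> a" "\<bar>y b\<bar> = pi"
        using IVT2'[of "\<lambda>s. \<bar>y s\<bar>" a pi 0] a_pos prof_y_a continuous_on_rabs[OF continuous_on_prof_y[of "{0..a}"]] by auto
      define x where "x = a - b"
      have "b \<noteq> a" using b(3) prof_y_a by auto
      then have x: "x > 0" "x \<in> {-a..a}" "- x \<in> {-a..a}" using b by (auto simp: x_def)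
      have "y b = pi \<or> y b = - pi" using b(3) by linarith
      then have "cis (- y b) = cis (y b)" by (auto simp: complex_eq_iff)
      then have "Psi (x, 0) = Psi (-x, 0)" using x(1) by (simp add: Psi_def x_def)
      then have "F (spherical \<sigma> (x, 0)) = F (spherical \<sigma> (-x, 0))" using eq x by simp
      then have "spherical \<sigma> (x, 0) = spherical \<sigma> (-x, 0)"
        by (rule inj_onD[OF inj]) (use spherical_in_S2 bd x in blast)+
      then have "\<sigma> x = \<sigma> (-x)" by (metis spherical_nth(3))
      moreover have "\<sigma> (-x) < \<sigma> x" using strict_mono_onD[OF s(1) x(3,2)] x(1) by simp
      ultimately show False by simp
    qed
  next
    assume y0: "\<bar>y 0\<bar> < pi"
    show "inj_on F S2"
    proof (rule inj_onI)
      fix p p' assume p: "p \<in> S2" "p' \<in> S2" "F p = F p'"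
      obtain x t where x: "x \<in> {-a..a}" "-pi < t" "t \<le> pi" "p = spherical \<sigma> (x, t)" using param[OF p(1)] by blast
      obtain x' t' where x': "x' \<in> {-a..a}" "-pi < t'" "t' \<le> pi" "p' = spherical \<sigma> (x', t')" using param[OF p(2)] by blast
      have Psi: "Psi (x, t) = Psi (x', t')" using p(3) eq x x' by simp
      define b where "b = a - \<bar>x\<bar>"
      have b: "0 \<le> b" "b \<le> a" using x(1) by (auto simp: b_def)
      have b': "0 \<le> a - \<bar>x'\<bar>" using x'(1) by auto
      have "cmod (fst (Psi (x, t))) = cmod (fst (Psi (x', t')))" using Psi by simp
      then have "cosh b = cosh (a - \<bar>x'\<bar>)" by (simp add: Psi_def norm_mult b_def)
      then have bb: "a - \<bar>x'\<bar> = b" using b b' by simp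
      then have xx: "\<bar>x'\<bar> = \<bar>x\<bar>" by (simp add: b_def)
      have c: "cis (- sgn x * y b) = cis (- sgn x' * y b)" "of_real (sinh b) * cis t = of_real (sinh b) * cis t'"
        using Psi by (simp_all add: Psi_def bb flip: b_def)
      have "x' = x"
      proof (rule ccontr)
        assume "x' \<noteq> x"
        then have "x' = - x" "x \<noteq> 0" using xx by auto
        then have "cis (y b) = cis (- y b)" using c(1) by (auto simp: sgn_if split: if_splits)
        then have "sin (y b) = 0" by (simp add: complex_eq_iff)
        moreover have "\<bar>y b\<bar> < pi" using prof_y_abs_le[OF b] y0 by simp
        \<comment> \<open>Of the zeros of the sine only 0 has absolute value below \<pi>, whereas y
          does not vanish before a.\<close>
        ultimately have "y b = 0" by (metis abs_less_iff minus_less_iff sin_eq_0_pi)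
        moreover have "b < a" using \<open>x \<noteq> 0\<close> by (simp add: b_def)
        ultimately show False using prof_y_neg[of b] b by simp
      qed
      moreover have "spherical \<sigma> (x, t) = spherical \<sigma> (x, t')"
      \<comment> \<open>At a pole the image does not determine t, but neither does the point of the
        sphere depend on it.\<close>
      proof (cases "b = 0")
        case True
        then have "x = a \<or> x = - a" by (auto simp: b_def)
        then have "(\<sigma> x)\<^sup>2 = 1" using s by auto
        then show ?thesis by (simp add: spherical_def)
      next
        case False
        then have "cis t = cis t'" using c(2) by simp
        then have "cos t = cos t'" "sin t = sin t'" by (simp_all add: complex_eq_iff)
        then show ?thesis by (simp add: spherical_def)
      qed
      ultimately show "p = p'" using x(4) x'(4) by simp
    qed
  qed
  then show ?thesis using embedding_iff_inj[OF imm] by simp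
qed

end

text \<open>The sign of y is opposite to that of \<tau>, so the symmetric condition |y(0)| < \<pi>
  becomes one-sided: y(0) > -\<pi> for positive \<tau>, and its mirror image y(0) < \<pi> for
  negative \<tau>.\<close>

theorem corollary2:
  fixes \<kappa> \<tau> H :: real
  assumes "\<kappa> < 0" and "\<tau> \<noteq> 0" and "H > 0" and "4 * H\<^sup>2 + \<kappa> > 0"
  shows "(\<exists>F. defines_sphere (half_length \<kappa> H) (Phi \<kappa> \<tau> H) F \<and> cmc_sphere_immersion \<kappa> \<tau> H F) \<and>
         (\<forall>F. defines_sphere (half_length \<kappa> H) (Phi \<kappa> \<tau> H) F \<longrightarrow>
            (\<tau> > 0 \<longrightarrow> (sphere_embedding F \<longleftrightarrow> prof_y \<kappa> \<tau> H 0 > - pi)) \<and>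
            (\<tau> < 0 \<longrightarrow> (sphere_embedding F \<longleftrightarrow> prof_y \<kappa> \<tau> H 0 < pi)))"
proof -
  interpret rotational_sphere \<kappa> \<tau> H using assms by unfold_locales
  have "\<tau> * prof_y \<kappa> \<tau> H 0 < 0" using prof_y_neg[of 0] a_pos by simp
  then have "\<tau> > 0 \<Longrightarrow> prof_y \<kappa> \<tau> H 0 < 0" "\<tau> < 0 \<Longrightarrow> prof_y \<kappa> \<tau> H 0 > 0"
    by (simp_all add: mult_less_0_iff)
  then show ?thesis
    using immersion_defines_sphere immersion_cmc embedding_iff by (auto simp: abs_less_iff)
qed

end
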